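(* Assume (A3), (A4), let $p\in(0,2]$ and $q<\frac p2$, and let $x$ be a bounded trajectory solution of (MTRIGS) with initial data $(x_0,v_0)$. Then, as $t\to+\infty$: (i) $\mathcal E^q_\lambda(t)=O(1)$ for every $0<\lambda<\frac\alpha2$; (ii) $\varphi_t(x(t))=O(t^{-2q})$; (iii) $\varphi(x(t))=O(t^{-2q})$; (iv) $\|x(t)-z(t)\|=O(1)$; (v) $\|\dot x(t)\|=O(t^{-q})$.
   Context: $\mathcal H$ real Hilbert space; $f_1,\dots,f_m:\mathcal H\to\mathbb R$ convex, continuously differentiable with Lipschitz continuous gradients; $F=(f_1,\dots,f_m)^\top$. Weak Pareto optimal: no $x$ with $f_i(x)<f_i(x^* )$ for all $i$; $\mathcal P_w$ the set of such points. $\mathcal L(F,b):=\{x:f_i(x)\le b_i\ \forall i\}$, $\mathcal{LP}_w(F,b):=\mathcal L(F,b)\cap\mathcal P_w$. Merit function $\varphi(x):=\sup_z\min_i(f_i(x)-f_i(z))$. Parameters $t_0>0$, $\alpha,\beta>0$, $q\in(0,1]$, $p\in(0,2]$, initial data $x_0,v_0\in\mathcal H$; $C(x):=\operatorname{conv}\{\nabla f_i(x)\}$. A trajectory solution of (MTRIGS) is $x:[t_0,\infty)\to\mathcal H$, continuously differentiable, with $\dot x$ absolutely continuous on each $[t_0,T]$ and a.e. derivative $\ddot x$ (Bochner measurable, $\dot x(t)=\dot x(t_0)+\int_{t_0}^t\ddot x$), satisfying $\frac{\alpha}{t^q}\dot x(t)+\operatorname{proj}_{C(x(t))+\frac{\beta}{t^p}x(t)+\ddot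 x(t)}(0)=0$ for a.e. $t\ge t_0$, $x(t_0)=x_0$, $\dot x(t_0)=v_0$. (A3): with $a_i:=\frac{\beta}{2t_0^p}\|x_0\|^2+\frac12\|v_0\|^2$, for every $x\in\mathcal L(F,F(x_0)+a)$, $\mathcal{LP}_w(F,F(x))\ne\emptyset$, and $R:=\sup_{F^*\in F(\mathcal{LP}_w(F,F(x_0)+a))}\inf_{z\in F^{-1}(\{F^*\})}\|z\|<\infty$. (A4): $S(w):=\operatorname{argmin}_z\max_i(f_i(z)-w_i)\neq\emptyset$ for all $w\in\mathbb R^m$ and $w\mapsto\operatorname{proj}_{S(w)}(0)$ is continuous. $f_{t,i}(x):=f_i(x)+\frac{\beta}{2t^p}\|x\|^2$; $\varphi_t(x):=\sup_z\min_i(f_{t,i}(x)-f_{t,i}(z))$; $z(t):=\operatorname{argmin}_z\max_i(f_{t,i}(z)-f_{t,i}(x(t)))$. For $r\in[q,1]$ and $\lambda>0$: $\mathcal E^r_\lambda(t):=t^{2r}\varphi_t(x(t))+\frac12\|\lambda(x(t)-z(t))+t^r\dot x(t)\|^2+\frac\lambda2\big(rt^{r-1}+\alpha t^{r-q}-2\lambda\big)\|x(t)-z(t)\|^2$. *)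

theory Defs
  imports "HOL-Analysis.Analysis" "HOL-Library.Landau_Symbols"
begin

text \<open>Objectives are indexed by a finite type 'm (so m = CARD('m) \<ge> 1); vectors in R^m
  are elements of real^'m.  The space 'a is a real Hilbert space.\<close>

definition Fvec :: "('m::finite \<Rightarrow> 'a \<Rightarrow> real) \<Rightarrow> 'a \<Rightarrow> real^'m" where
  "Fvec f x = (\<chi> i. f i x)"

definition weak_pareto :: "('m::finite \<Rightarrow> 'a \<Rightarrow> real) \<Rightarrow> 'a \<Rightarrow> bool" where
  "weak_pareto f xs \<longleftrightarrow> \<not> (\<exists>x. \<forall>i. f i x < f i xs)"

definition level_set :: "('m::finite \<Rightarrow> 'a \<Rightarrow> real) \<Rightarrow> real^'m \<Rightarrow> 'a set" where
  "level_set f b = {x. \<forall>i. f i x \<le> b $ i}"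

definition LPw :: "('m::finite \<Rightarrow> 'a \<Rightarrow> real) \<Rightarrow> real^'m \<Rightarrow> 'a set" where
  "LPw f b = level_set f b \<inter> {x. weak_pareto f x}"

definition merit :: "('m::finite \<Rightarrow> 'a \<Rightarrow> real) \<Rightarrow> 'a \<Rightarrow> real" where
  "merit f x = (SUP z. Min (range (\<lambda>i. f i x - f i z)))"

definition freg :: "('m::finite \<Rightarrow> 'a::real_normed_vector \<Rightarrow> real) \<Rightarrow> real \<Rightarrow> real \<Rightarrow> real \<Rightarrow> 'm \<Rightarrow> 'a \<Rightarrow> real" where
  "freg f \<beta> p t i x = f i x + \<beta> / (2 * t powr p) * (norm x)\<^sup>2"

text \<open>\<open>z(t) = argmin_z max_i (f_{t,i}(z) - f_{t,i}(y))\<close> (unique by strong convexity).\<close>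
definition zreg :: "('m::finite \<Rightarrow> 'a::real_normed_vector \<Rightarrow> real) \<Rightarrow> real \<Rightarrow> real \<Rightarrow> real \<Rightarrow> 'a \<Rightarrow> 'a" where
  "zreg f \<beta> p t y = (THE z. \<forall>w. Max (range (\<lambda>i. freg f \<beta> p t i z - freg f \<beta> p t i y))
                            \<le> Max (range (\<lambda>i. freg f \<beta> p t i w - freg f \<beta> p t i y)))"

definition proj :: "'a::real_normed_vector set \<Rightarrow> 'a \<Rightarrow> 'a" where
  "proj S y = (THE u. u \<in> S \<and> (\<forall>v\<in>S. dist y u \<le> dist y v))"

definition Sset :: "('m::finite \<Rightarrow> 'a \<Rightarrow> real) \<Rightarrow> real^'m \<Rightarrow> 'a set" where
  "Sset f w = {z. \<forall>u. Max (range (\<lambda>i. f i z - w $ i)) \<le> Max (range (\<lambda>i. f i u - w $ i))}"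

definition abs_cont_on :: "real set \<Rightarrow> (real \<Rightarrow> 'a::real_normed_vector) \<Rightarrow> bool" where
  "abs_cont_on S g \<longleftrightarrow> (\<forall>\<epsilon>>0. \<exists>\<delta>>0. \<forall>(n::nat) (a::nat \<Rightarrow> real) b.
      (\<forall>k<n. a k \<le> b k \<and> {a k..b k} \<subseteq> S) \<and>
      (\<forall>j<n. \<forall>k<n. j \<noteq> k \<longrightarrow> b j \<le> a k \<or> b k \<le> a j) \<and>
      (\<Sum>k<n. b k - a k) < \<delta> \<longrightarrow> (\<Sum>k<n. norm (g (b k) - g (a k))) < \<epsilon>)"

definition mtrigs_solution ::
  "('m::finite \<Rightarrow> 'a::{real_inner,complete_space} \<Rightarrow> real) \<Rightarrow> ('m \<Rightarrow> 'a \<Rightarrow> 'a) \<Rightarrow>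
   real \<Rightarrow> real \<Rightarrow> real \<Rightarrow> real \<Rightarrow> real \<Rightarrow> 'a \<Rightarrow> 'a \<Rightarrow>
   (real \<Rightarrow> 'a) \<Rightarrow> (real \<Rightarrow> 'a) \<Rightarrow> (real \<Rightarrow> 'a) \<Rightarrow> bool" where
  "mtrigs_solution f g t0 \<alpha> \<beta> q p x0 v0 x x' x'' \<longleftrightarrow>
     (\<forall>t\<ge>t0. (x has_vector_derivative x' t) (at t within {t0..})) \<and>
     continuous_on {t0..} x' \<and>
     (\<forall>T\<ge>t0. abs_cont_on {t0..T} x') \<and>
     (AE t in lborel. t \<ge> t0 \<longrightarrow>
        (x' has_vector_derivative x'' t) (at t) \<and>
        (\<alpha> / t powr q) *\<^sub>R x' t
          + proj ((\<lambda>c. c + (\<beta> / t powr p) *\<^sub>R x t + x'' t) ` (convex hull (range (\<lambda>i. g i (x t))))) 0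
          = 0) \<and>
     x t0 = x0 \<and> x' t0 = v0"

definition energy ::
  "('m::finite \<Rightarrow> 'a::real_inner \<Rightarrow> real) \<Rightarrow> real \<Rightarrow> real \<Rightarrow> real \<Rightarrow> real \<Rightarrow>
   (real \<Rightarrow> 'a) \<Rightarrow> (real \<Rightarrow> 'a) \<Rightarrow> real \<Rightarrow> real \<Rightarrow> real \<Rightarrow> real" where
  "energy f \<alpha> \<beta> q p x x' r lam t =
     (let z = zreg f \<beta> p t (x t) in
      t powr (2 * r) * merit (freg f \<beta> p t) (x t)
      + 1/2 * (norm (lam *\<^sub>R (x t - z) + (t powr r) *\<^sub>R x' t))\<^sup>2
      + lam/2 * (r * t powr (r - 1) + \<alpha> * t powr (r - q) - 2 * lam) * (norm (x t - z))\<^sup>2)"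

end

theory Submission
  imports Defs
begin

text \<open>The minimizer \<open>z(t)\<close> moves with time, but it need not be differentiated: fix the final time \<open>T\<close>
  and compare the whole trajectory with the frozen point \<open>z(T)\<close>. The variational inequality for
  the projection makes each \<open>f\<^sub>t\<^sub>,\<^sub>i(x(t)) + \<parallel>x'(t)\<parallel>\<^sup>2 / 2\<close> decrease with dissipation
  \<open>\<alpha> t\<^sup>-\<^sup>q \<parallel>x'\<parallel>\<^sup>2\<close>, so that for every \<open>t \<le> T\<close> and every \<open>i\<close> the gap
  \<open>f\<^sub>t\<^sub>,\<^sub>i(x(t)) - f\<^sub>t\<^sub>,\<^sub>i(z(T))\<close> is bounded below by the merit value at time \<open>T\<close>, up to kinetic energy,
  dissipation and an error \<open>O(t\<^sup>-\<^sup>p)\<close>. Inserting this in the second-order equation for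
  \<open>h = \<parallel>x - z(T)\<parallel>\<^sup>2 / 2\<close>, which is bounded uniformly in \<open>T\<close>, and multiplying by \<open>t\<^sup>2\<^sup>q\<^sup>-\<^sup>1\<close> gives
  a Lyapunov function whose remaining terms are integrable because \<open>2q < p\<close> and \<open>q < 1\<close>.\<close>

section \<open>Monotonicity of absolutely continuous functions\<close>

text \<open>A Henstock-type argument that involves no integral of the derivative. On a fine enough
  tagged division, an interval whose tag has a derivative \<open>D \<le> 0\<close> contributes at
  most \<open>\<eta>\<close> times its length. The intervals tagged in the null set \<open>N\<close>
  have small total length, so absolute continuity controls their increments. Each of the two
  contributions is given \<open>e / 2\<close>.\<close>

lemma abs_cont_on_nonincreasing:
  fixes F :: "real \<Rightarrow> real"
  assumes ab: "a \<le> b" and ac: "abs_cont_on {a..b} F"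
    and deriv: "AE t in lborel. t \<in> {a<..<b} \<longrightarrow> (\<exists>D\<le>0. (F has_real_derivative D) (at t))"
  shows "F b \<le> F a"
proof (rule field_le_epsilon)
  fix e :: real assume e: "e > 0"
  define N where "N = {t \<in> {a..b}. \<not> (\<exists>D\<le>0. (F has_real_derivative D) (at t))}"
  have "negligible N"
  proof -
    obtain M where M: "M \<in> null_sets lborel"
        "{t. \<not> (t \<in> {a<..<b} \<longrightarrow> (\<exists>D\<le>0. (F has_real_derivative D) (at t)))} \<subseteq> M"
      using deriv unfolding eventually_ae_filter by auto
    have "negligible M"
      using M(1) by (simp add: negligible_iff_null_sets null_sets_completionI)
    then have "negligible (M \<union> {a, b})" by simp
    moreover have "N \<subseteq> M \<union> {a, b}"
    proof
      fix t assume t: "t \<in> N"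
      show "t \<in> M \<union> {a, b}"
      proof (cases "t \<in> {a<..<b}")
        case True
        then show ?thesis using t M(2) unfolding N_def by blast
      next
        case False
        then show ?thesis using t by (auto simp: N_def)
      qed
    qed
    ultimately show ?thesis by (rule negligible_subset)
  qed
  \<comment> \<open>Chosen so that \<open>\<eta> * (b - a) \<le> e / 2\<close>; the summand 1 keeps
    the denominator positive when \<open>a = b\<close>.\<close>
  define \<eta> where "\<eta> = e / (2 * (b - a + 1))"
  have \<eta>: "\<eta> > 0" using e ab by (simp add: \<eta>_def)
  have "\<exists>\<delta>>0. \<forall>(n::nat) (l::nat \<Rightarrow> real) r.
      (\<forall>k<n. l k \<le> r k \<and> {l k..r k} \<subseteq> {a..b}) \<and>
      (\<forall>j<n. \<forall>k<n. j \<noteq> k \<longrightarrow> r j \<le> l k \<or> r k \<le> l j) \<and>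
      (\<Sum>k<n. r k - l k) < \<delta> \<longrightarrow> (\<Sum>k<n. norm (F (r k) - F (l k))) < e / 2"
    by (rule mp[OF spec[OF ac[unfolded abs_cont_on_def], of "e / 2"]]) (use e in simp)
  then obtain \<delta> where \<delta>: "\<delta> > 0" and small: "\<forall>(n::nat) (l::nat \<Rightarrow> real) r.
      (\<forall>k<n. l k \<le> r k \<and> {l k..r k} \<subseteq> {a..b}) \<and>
      (\<forall>j<n. \<forall>k<n. j \<noteq> k \<longrightarrow> r j \<le> l k \<or> r k \<le> l j) \<and>
      (\<Sum>k<n. r k - l k) < \<delta> \<longrightarrow> (\<Sum>k<n. norm (F (r k) - F (l k))) < e / 2"
    by blast
  \<comment> \<open>A null set has an indicator with gauge integral 0, and its Riemann sums over
    \<open>\<gamma>1\<close>-fine divisions are exactly the total length of the intervals tagged in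
    \<open>N\<close>. This length can therefore be forced below the \<open>\<delta>\<close> of
    absolute continuity.\<close>
  have "((indicat_real N) has_integral 0) (cbox a b)"
    using \<open>negligible N\<close> unfolding negligible_def by blast
  then obtain \<gamma>1 where \<gamma>1: "gauge \<gamma>1"
    "\<And>P. P tagged_division_of (cbox a b) \<Longrightarrow> \<gamma>1 fine P \<Longrightarrow>
       norm ((\<Sum>(x,K)\<in>P. measure lborel K *\<^sub>R indicat_real N x) - 0) < \<delta>"
    using \<delta> unfolding has_integral by meson
  \<comment> \<open>Straddle estimate: the tag lies between \<open>u\<close> and \<open>v\<close>,
    so the linear part \<open>D * (v - u)\<close> is nonpositive and only the remainder, at most
    \<open>\<eta> * (v - u)\<close>, survives. Tags in \<open>N\<close> may get any radius.\<close>
  have "\<exists>d>0. t \<in> {a..b} - N \<longrightarrow> (\<forall>u v. u \<le> t \<and> t \<le> v \<and> t - d < u \<and> v < t + d \<longrightarrow> F v - F u \<le> \<eta> * (v - u))" for t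
  proof (cases "t \<in> {a..b} - N")
    case True
    then obtain D where D: "D \<le> 0" "(F has_real_derivative D) (at t)"
      by (auto simp: N_def)
    from D(2) have "(F has_derivative (\<lambda>h. D * h)) (at t)"
      by (simp add: has_field_derivative_def)
    then obtain d where d: "d > 0" "\<And>s. \<bar>s - t\<bar> < d \<Longrightarrow> \<bar>F s - F t - D * (s - t)\<bar> \<le> \<eta> * \<bar>s - t\<bar>"
      using \<eta> unfolding has_derivative_at_alt by (auto simp: real_norm_def)
    have "F v - F u \<le> \<eta> * (v - u)" if "u \<le> t" "t \<le> v" "t - d < u" "v < t + d" for u v
    proof -
      have "\<bar>F v - F t - D * (v - t)\<bar> \<le> \<eta> * \<bar>v - t\<bar>" "\<bar>F u - F t - D * (u - t)\<bar> \<le> \<eta> * \<bar>u - t\<bar>"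
        using d(2)[of v] d(2)[of u] that by auto
      moreover have "D * (v - t) \<le> 0" "D * (u - t) \<ge> 0"
        using D(1) that by (auto simp: mult_nonpos_nonneg mult_nonpos_nonpos)
      moreover have "\<eta> * \<bar>v - t\<bar> + \<eta> * \<bar>u - t\<bar> = \<eta> * (v - u)"
        using that by (simp add: algebra_simps)
      ultimately show ?thesis by linarith
    qed
    then show ?thesis using d(1) by blast
  qed (use zero_less_one in blast)
  then have "\<exists>d. \<forall>t. d t > 0 \<and> (t \<in> {a..b} - N \<longrightarrow>
      (\<forall>u v. u \<le> t \<and> t \<le> v \<and> t - d t < u \<and> v < t + d t \<longrightarrow> F v - F u \<le> \<eta> * (v - u)))"
    by (intro choice allI)
  then obtain d where d: "\<forall>t. d t > 0 \<and> (t \<in> {a..b} - N \<longrightarrow>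
      (\<forall>u v. u \<le> t \<and> t \<le> v \<and> t - d t < u \<and> v < t + d t \<longrightarrow> F v - F u \<le> \<eta> * (v - u)))" ..
  have "gauge (\<lambda>t. \<gamma>1 t \<inter> ball t (d t))"
    using \<gamma>1(1) d by (intro gauge_Int gauge_ball_dependent) blast+
  then obtain P where P: "P tagged_division_of {a..b}" "(\<lambda>t. \<gamma>1 t \<inter> ball t (d t)) fine P"
    using fine_division_exists_real by blast
  have "finite P" using P(1) by blast
  have interval: "\<exists>l r. K = {l..r} \<and> l \<le> t \<and> t \<le> r \<and> a \<le> l \<and> r \<le> b \<and> t - d t < l \<and> r < t + d t" 
    if tK: "(t, K) \<in> P" for t K
  proof -
    obtain l r where lr: "K = cbox l r" using tagged_division_ofD(4)[OF P(1) tK] by blast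
    have 1: "t \<in> K" "K \<subseteq> {a..b}" using tagged_division_ofD(2,3)[OF P(1) tK] by auto
    have 2: "K \<subseteq> ball t (d t)" using fineD[OF P(2) tK] by auto
    have 3: "l \<le> t" "t \<le> r" "l \<in> K" "r \<in> K" using 1 lr by auto
    then have "dist t l < d t" "dist t r < d t" using 2 by auto
    then show ?thesis using 1 3 lr by (intro exI[of _ l] exI[of _ r]) (auto simp: dist_real_def)
  qed
  let ?D = "\<lambda>(t::real, K). F (Sup K) - F (Inf K)"
  \<comment> \<open>A degenerate interval may lie inside another one of the division, so it has to be left out of
    the family to which absolute continuity is applied.\<close>
  define PN where "PN = {c \<in> P. fst c \<in> N \<and> 0 < measure lborel (snd c)}"
  have finPN: "finite PN" using \<open>finite P\<close> by (simp add: PN_def)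
  have "F b - F a = (\<Sum>c\<in>P. ?D c)"
    using additive_tagged_division_1[OF ab P(1), of F] by simp
  also have "\<dots> = (\<Sum>c\<in>PN. ?D c) + (\<Sum>c\<in>P - PN. ?D c)"
    using \<open>finite P\<close> by (subst sum.subset_diff[of PN P]) (auto simp: PN_def)
  also have "(\<Sum>c\<in>P - PN. ?D c) \<le> (\<Sum>c\<in>P - PN. \<eta> * measure lborel (snd c))"
  proof (rule sum_mono)
    fix c assume c: "c \<in> P - PN"
    obtain t K where tK: "c = (t, K)" by fastforce
    obtain l r where lr: "K = {l..r}" "l \<le> t" "t \<le> r" "a \<le> l" "r \<le> b" "t - d t < l" "r < t + d t"
      using interval[of t K] c tK by auto
    show "?D c \<le> \<eta> * measure lborel (snd c)"
    proof (cases "t \<in> N")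
      case True
      then have "l = r" using lr c tK by (auto simp: PN_def)
      then show ?thesis using lr tK by simp
    next
      case False
      then have "t \<in> {a..b} - N" using lr by auto
      then have "F r - F l \<le> \<eta> * (r - l)" using d lr(2,3,6,7) by blast
      then show ?thesis using lr tK by simp
    qed
  qed
  also have "\<dots> \<le> (\<Sum>c\<in>P. \<eta> * measure lborel (snd c))"
    using \<open>finite P\<close> \<eta> by (intro sum_mono2) auto
  also have "\<dots> = \<eta> * (b - a)"
    using additive_content_tagged_division[of P a b] P(1) ab
    by (simp add: sum_distrib_left[symmetric] split_def)
  also have "\<dots> \<le> e / 2"
    using e ab by (simp add: \<eta>_def field_simps)
  also have "(\<Sum>c\<in>PN. ?D c) \<le> e / 2"
  proof -
    \<comment> \<open>Absolute continuity speaks of families indexed by an initial segment of the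
      naturals, hence the enumeration of \<open>PN\<close>.\<close>
    obtain c where c: "bij_betw c {..<card PN} PN"
      using ex_bij_betw_nat_finite[OF finPN] by (auto simp: atLeast0LessThan)
    define l where "l k = Inf (snd (c k))" for k
    define r where "r k = Sup (snd (c k))" for k
    have cP: "c k \<in> P" if "k < card PN" for k
      using bij_betwE[OF c] that by (auto simp: PN_def)
    have ck: "snd (c k) = {l k..r k}" "l k < r k" "a \<le> l k" "r k \<le> b" if k: "k < card PN" for k
    proof -
      have "(fst (c k), snd (c k)) \<in> P" using cP[OF k] by simp
      from interval[OF this] obtain u v where uv: "snd (c k) = {u..v}" "u \<le> v" "a \<le> u" "v \<le> b"
        by fastforce
      have "l k = u" "r k = v" using uv(1,2) by (simp_all add: l_def r_def)
      moreover have "0 < measure lborel (snd (c k))"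
        using bij_betwE[OF c] k by (auto simp: PN_def)
      ultimately show "snd (c k) = {l k..r k}" "l k < r k" "a \<le> l k" "r k \<le> b"
        using uv by auto
    qed
    have "(\<Sum>k<card PN. norm (F (r k) - F (l k))) < e / 2"
    proof (intro small[rule_format] conjI allI impI)
      fix j k assume jk: "j < card PN" "k < card PN" "j \<noteq> k"
      then have "c j \<noteq> c k" using c by (auto simp: bij_betw_def inj_on_def)
      then have "interior (snd (c j)) \<inter> interior (snd (c k)) = {}"
        using tagged_division_ofD(5)[OF P(1), of "fst (c j)" "snd (c j)" "fst (c k)" "snd (c k)"] cP jk
        by auto
      then have "{l j<..<r j} \<inter> {l k<..<r k} = {}" using ck(1) jk by simp
      then show "r j \<le> l k \<or> r k \<le> l j"
        using ck(2)[of j] ck(2)[of k] jk by (auto simp: max_def min_def split: if_splits)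
    next
      have "(\<Sum>k<card PN. r k - l k) = (\<Sum>k<card PN. measure lborel (snd (c k)))"
        using ck by (intro sum.cong) (auto simp: less_imp_le)
      also have "\<dots> = (\<Sum>c\<in>PN. measure lborel (snd c))"
        by (rule sum.reindex_bij_betw[OF c])
      also have "\<dots> = (\<Sum>c\<in>P. measure lborel (snd c) * indicat_real N (fst c))"
        using \<open>finite P\<close> by (intro sum.mono_neutral_cong_left) (auto simp: PN_def indicator_def zero_less_measure_iff)
      also have "\<dots> < \<delta>"
        using \<gamma>1(2)[of P] P by (auto simp: split_def fine_Int)
      finally show "(\<Sum>k<card PN. r k - l k) < \<delta>" .
    qed (use ck in \<open>fastforce simp: less_imp_le\<close>)+
    moreover have "(\<Sum>c\<in>PN. ?D c) = (\<Sum>k<card PN. F (r k) - F (l k))"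
      using sum.reindex_bij_betw[OF c, of ?D] by (simp add: split_def l_def r_def)
    moreover have "\<dots> \<le> (\<Sum>k<card PN. norm (F (r k) - F (l k)))"
      by (intro sum_mono) auto
    ultimately show ?thesis by linarith
  qed
  finally show "F b \<le> F a + e" by simp
qed

section \<open>Strongly convex minimization and projections\<close>

lemma norm_midpoint_sq:
  fixes u v :: "'a::real_inner"
  shows "(norm ((1/2) *\<^sub>R (u + v)))\<^sup>2 = (norm u)\<^sup>2 / 2 + (norm v)\<^sup>2 / 2 - (norm (u - v))\<^sup>2 / 4"
  by (simp add: power2_norm_eq_inner inner_add_left inner_add_right inner_diff_left inner_diff_right
      inner_commute algebra_simps divide_simps)

text \<open>By the parallelogram law the quadratic term makes every minimizing sequence Cauchy, so
  completeness replaces weak compactness. The same estimate gives uniqueness. The lemma serves both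
  the projection onto a convex set and the regularized minimizer \<open>zreg\<close>.\<close>

lemma ex1_argmin_convex_plus_sq_norm:
  fixes h :: "'a::{real_inner,complete_space} \<Rightarrow> real"
  assumes S: "convex S" "closed S" "S \<noteq> {}"
    and h: "convex_on S h" "continuous_on S h" and lower: "\<And>y. y \<in> S \<Longrightarrow> B \<le> h y" and c: "c > 0"
  shows "\<exists>!z. z \<in> S \<and> (\<forall>y\<in>S. h z + c * (norm z)\<^sup>2 \<le> h y + c * (norm y)\<^sup>2)"
proof -
  define \<phi> where "\<phi> y = h y + c * (norm y)\<^sup>2" for y
  have mid: "\<phi> ((1/2) *\<^sub>R (u + v)) \<le> \<phi> u / 2 + \<phi> v / 2 - c / 4 * (norm (u - v))\<^sup>2"
    "(1/2) *\<^sub>R (u + v) \<in> S"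
    if "u \<in> S" "v \<in> S" for u v
  proof -
    have "h ((1/2) *\<^sub>R u + (1/2) *\<^sub>R v) \<le> (1/2) * h u + (1/2) * h v"
      using convex_onD[OF h(1), of "1/2" u v] that by simp
    then show "\<phi> ((1/2) *\<^sub>R (u + v)) \<le> \<phi> u / 2 + \<phi> v / 2 - c / 4 * (norm (u - v))\<^sup>2"
      unfolding \<phi>_def norm_midpoint_sq by (simp add: scaleR_add_right algebra_simps add_divide_distrib)
    show "(1/2) *\<^sub>R (u + v) \<in> S"
      using convexD[OF S(1) that, of "1/2" "1/2"] by (simp add: scaleR_add_right)
  qed
  define I where "I = Inf (\<phi> ` S)"
  have bdd: "bdd_below (\<phi> ` S)"
    using lower c by (intro bdd_belowI[of _ B]) (auto simp: \<phi>_def intro: add_increasing2)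
  have I_le: "I \<le> \<phi> y" if "y \<in> S" for y
    unfolding I_def using that bdd by (intro cInf_lower) auto
  \<comment> \<open>The midpoint of two points whose values exceed the infimum by at most
    \<open>e\<close> cannot go below the infimum, which bounds their distance.\<close>
  have close: "(norm (u - v))\<^sup>2 \<le> 4 / c * e" if "u \<in> S" "v \<in> S" "\<phi> u \<le> I + e" "\<phi> v \<le> I + e" for u v e
  proof -
    have "c / 4 * (norm (u - v))\<^sup>2 \<le> e"
      using mid[OF that(1,2)] I_le[of "(1/2) *\<^sub>R (u + v)"] that(3,4) by linarith
    then show ?thesis using c by (simp add: field_simps)
  qed
  have "\<exists>y\<in>S. \<phi> y < I + 1 / real (Suc n)" for n
  proof -
    have "Inf (\<phi> ` S) < I + 1 / real (Suc n)" by (simp add: I_def)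
    then show ?thesis using cInf_lessD[of "\<phi> ` S"] S(3) by blast
  qed
  then obtain Y where Y: "\<And>n. Y n \<in> S" "\<And>n. \<phi> (Y n) < I + 1 / real (Suc n)" by metis
  have "Cauchy Y"
  proof (rule metric_CauchyI)
    fix e :: real assume e: "e > 0"
    obtain N where N: "1 / real (Suc N) < c / 4 * e\<^sup>2"
      using e c nat_approx_posE[of "c / 4 * e\<^sup>2"] by auto
    show "\<exists>N. \<forall>m\<ge>N. \<forall>n\<ge>N. dist (Y m) (Y n) < e"
    proof (intro exI allI impI)
      fix m n assume "m \<ge> N" "n \<ge> N"
      then have "1 / real (Suc m) \<le> 1 / real (Suc N)" "1 / real (Suc n) \<le> 1 / real (Suc N)"
        by (auto simp: field_simps)
      then have "(norm (Y m - Y n))\<^sup>2 \<le> 4 / c * (1 / real (Suc N))"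
        using Y(2)[of m] Y(2)[of n] by (intro close Y(1)) linarith+
      also have "\<dots> < 4 / c * (c / 4 * e\<^sup>2)"
        using N c by (intro mult_strict_left_mono) auto
      also have "\<dots> = e\<^sup>2" using c by simp
      finally show "dist (Y m) (Y n) < e"
        using e by (simp add: dist_norm power2_less_imp_less)
    qed
  qed
  then obtain z where z: "Y \<longlonglongrightarrow> z"
    using Cauchy_convergent convergent_def by blast
  have zS: "z \<in> S" using closed_sequentially[OF S(2) _ z] Y(1) by blast
  have "continuous_on S \<phi>" unfolding \<phi>_def by (intro continuous_intros h)
  then have "(\<lambda>n. \<phi> (Y n)) \<longlonglongrightarrow> \<phi> z"
    using continuous_on_sequentially[of S \<phi>] zS z Y(1) by (auto simp: o_def)
  moreover have "(\<lambda>n. I + 1 / real (Suc n)) \<longlonglongrightarrow> I + 0"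
    by (intro tendsto_intros LIMSEQ_Suc[OF lim_1_over_n])
  ultimately have "\<phi> z \<le> I + 0"
    by (rule LIMSEQ_le) (use Y(2) in \<open>auto intro: less_imp_le\<close>)
  then have min: "\<forall>y\<in>S. \<phi> z \<le> \<phi> y" using I_le by fastforce
  moreover have "u = z" if "u \<in> S" "\<forall>y\<in>S. \<phi> u \<le> \<phi> y" for u
  proof -
    have "\<phi> u \<le> I + 0" using that zS \<open>\<phi> z \<le> I + 0\<close> by fastforce
    from close[OF that(1) zS this \<open>\<phi> z \<le> I + 0\<close>] show ?thesis by simp
  qed
  ultimately show ?thesis using zS unfolding \<phi>_def by blast
qed

lemma convex_on_Max:
  fixes h :: "'m::finite \<Rightarrow> 'a::real_vector \<Rightarrow> real"
  assumes "\<And>i. convex_on S (h i)"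
  shows "convex_on S (\<lambda>z. Max (range (\<lambda>i. h i z)))"
proof (rule convex_onI)
  fix t :: real and u v assume t: "0 < t" "t < 1" and uv: "u \<in> S" "v \<in> S"
  have "h i ((1 - t) *\<^sub>R u + t *\<^sub>R v) \<le> (1 - t) * Max (range (\<lambda>i. h i u)) + t * Max (range (\<lambda>i. h i v))" for i
  proof -
    have "h i ((1 - t) *\<^sub>R u + t *\<^sub>R v) \<le> (1 - t) * h i u + t * h i v"
      using convex_onD[OF assms, of t u v i] t uv by auto
    also have "\<dots> \<le> (1 - t) * Max (range (\<lambda>i. h i u)) + t * Max (range (\<lambda>i. h i v))"
      using t by (intro add_mono mult_left_mono Max_ge) auto
    finally show ?thesis .
  qed
  then show "Max (range (\<lambda>i. h i ((1 - t) *\<^sub>R u + t *\<^sub>R v)))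
      \<le> (1 - t) * Max (range (\<lambda>i. h i u)) + t * Max (range (\<lambda>i. h i v))"
    by (subst Max_le_iff) auto
qed (use assms convex_on_imp_convex in blast)

lemma continuous_on_Max:
  fixes h :: "'m::finite \<Rightarrow> 'a::topological_space \<Rightarrow> real"
  assumes "\<And>i. continuous_on S (h i)"
  shows "continuous_on S (\<lambda>z. Max (range (\<lambda>i. h i z)))"
proof -
  have *: "continuous_on S (\<lambda>z. Max ((\<lambda>i. h i z) ` J))" if "finite J" "J \<noteq> {}" for J
    using that
  proof (induction J rule: finite_ne_induct)
    case (singleton i)
    then show ?case using assms by simp
  next
    case (insert i J)
    have "(\<lambda>z. Max ((\<lambda>i. h i z) ` insert i J)) = (\<lambda>z. max (h i z) (Max ((\<lambda>i. h i z) ` J)))"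
      using insert by (auto simp: Max_insert)
    then show ?case using continuous_on_max[OF assms insert.IH] by metis
  qed
  show ?thesis using *[of UNIV] by simp
qed

text \<open>The minimization lemma with \<open>h = 0\<close> and \<open>c = 1\<close>; it shows that
  the definite description in \<open>proj\<close> denotes a nearest point.\<close>

lemma proj_mem_le:
  fixes S :: "'a::{real_inner,complete_space} set"
  assumes "convex S" "closed S" "S \<noteq> {}"
  shows "proj S 0 \<in> S" "\<And>v. v \<in> S \<Longrightarrow> norm (proj S 0) \<le> norm v"
proof -
  have iff: "(norm z)\<^sup>2 \<le> (norm y)\<^sup>2 \<longleftrightarrow> norm z \<le> norm y" for z y :: 'a
    by simp
  have "\<exists>!z. z \<in> S \<and> (\<forall>y\<in>S. 0 + 1 * (norm z)\<^sup>2 \<le> 0 + 1 * (norm y)\<^sup>2)"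
    by (rule ex1_argmin_convex_plus_sq_norm[where B = 0, OF assms]) (auto simp: convex_on_def assms(1))
  then have "\<exists>!z. z \<in> S \<and> (\<forall>y\<in>S. dist 0 z \<le> dist 0 y)"
    by (simp add: iff)
  from theI'[OF this] show "proj S 0 \<in> S" "\<And>v. v \<in> S \<Longrightarrow> norm (proj S 0) \<le> norm v"
    unfolding proj_def by simp_all
qed

text \<open>If the inner product were negative, a short move from the projection towards
  \<open>v\<close> would stay in \<open>S\<close> and decrease the norm.\<close>

lemma proj_variational_inequality:
  fixes S :: "'a::{real_inner,complete_space} set"
  assumes "convex S" "closed S" "v \<in> S"
  shows "inner (proj S 0) (v - proj S 0) \<ge> 0"
proof (rule ccontr)
  let ?u = "proj S 0"
  have S: "S \<noteq> {}" using assms by blast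
  note u = proj_mem_le[OF assms(1,2) S]
  assume "\<not> ?thesis"
  then have neg: "inner ?u (v - ?u) < 0" by simp
  define d where "d = - inner ?u (v - ?u)"
  have d: "d > 0" using neg by (simp add: d_def)
  \<comment> \<open>With this step length the quadratic term is at most \<open>s * d\<close>, half
    of the linear gain \<open>2 * s * d\<close>; the cap at 1 keeps the new point on the
    segment.\<close>
  define s where "s = min 1 (d / (norm (v - ?u))\<^sup>2)"
  have vu: "norm (v - ?u) > 0" using neg by auto
  have s: "0 < s" "s \<le> 1" using d vu by (auto simp: s_def)
  have "s \<le> d / (norm (v - ?u))\<^sup>2" by (simp add: s_def)
  then have sd: "s * (norm (v - ?u))\<^sup>2 \<le> d" using vu by (simp add: field_simps)
  have "(1 - s) *\<^sub>R ?u + s *\<^sub>R v \<in> S"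
    using s u(1) assms by (intro convexD) auto
  moreover have "(1 - s) *\<^sub>R ?u + s *\<^sub>R v = ?u + s *\<^sub>R (v - ?u)"
    by (simp add: algebra_simps)
  ultimately have "norm ?u \<le> norm (?u + s *\<^sub>R (v - ?u))" using u(2) by simp
  then have "(norm ?u)\<^sup>2 \<le> (norm (?u + s *\<^sub>R (v - ?u)))\<^sup>2" by (simp add: power_mono)
  also have "\<dots> = (norm ?u)\<^sup>2 - 2 * s * d + s * (s * (norm (v - ?u))\<^sup>2)"
    unfolding d_def power2_norm_eq_inner inner_add_left inner_add_right inner_scaleR_left inner_scaleR_right
    using inner_commute[of ?u "v - ?u"] by (simp only:) (simp add: algebra_simps)
  also have "\<dots> \<le> (norm ?u)\<^sup>2 - 2 * s * d + s * d"
    using sd s by (intro add_left_mono mult_left_mono) auto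
  finally have "s * d \<le> 0" by linarith
  then show False using s d mult_pos_pos[of s d] by linarith
qed

text \<open>Restriction to the line through \<open>y\<close> and \<open>z\<close> reduces this to
  the tangent inequality for convex functions of one real variable.\<close>

lemma convex_gradient_ineq:
  fixes f :: "'a::real_inner \<Rightarrow> real"
  assumes "convex_on UNIV f" and "(f has_derivative (\<lambda>h. inner g h)) (at y)"
  shows "f y + inner g (z - y) \<le> f z"
proof -
  define \<phi> where "\<phi> s = f (y + s *\<^sub>R (z - y))" for s :: real
  have "convex_on UNIV \<phi>"
  proof (rule convex_onI)
    fix t u v :: real assume t: "0 < t" "t < 1"
    have "y + ((1 - t) *\<^sub>R u + t *\<^sub>R v) *\<^sub>R (z - y)
        = (1 - t) *\<^sub>R (y + u *\<^sub>R (z - y)) + t *\<^sub>R (y + v *\<^sub>R (z - y))"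
      by (simp add: algebra_simps)
    then show "\<phi> ((1 - t) *\<^sub>R u + t *\<^sub>R v) \<le> (1 - t) * \<phi> u + t * \<phi> v"
      unfolding \<phi>_def using convex_onD[OF assms(1), of t] t by simp
  qed simp
  moreover have "(\<phi> has_field_derivative inner g (z - y)) (at 0)"
  proof -
    have "((\<lambda>s::real. y + s *\<^sub>R (z - y)) has_derivative (\<lambda>s. s *\<^sub>R (z - y))) (at 0)"
      by (auto intro!: derivative_eq_intros)
    moreover have "(f has_derivative (\<lambda>h. inner g h)) (at (y + 0 *\<^sub>R (z - y)))"
      using assms(2) by simp
    ultimately have "((\<lambda>s. f (y + s *\<^sub>R (z - y))) has_derivative (\<lambda>s. inner g (s *\<^sub>R (z - y)))) (at 0)"
      by (rule has_derivative_compose)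
    then show ?thesis
      unfolding \<phi>_def has_field_derivative_def by (simp add: mult.commute[of _ "inner g (z - y)"] fun_eq_iff)
  qed
  ultimately have "\<phi> 1 - \<phi> 0 \<ge> inner g (z - y) * (1 - 0)"
    by (intro convex_on_imp_above_tangent[of UNIV]) auto
  then show ?thesis by (simp add: \<phi>_def)
qed

section \<open>Closure properties of absolute continuity\<close>

lemma abs_cont_on_ident: "abs_cont_on S (\<lambda>t. t)"
  unfolding abs_cont_on_def
proof (intro allI impI)
  fix e :: real assume "e > 0"
  then show "\<exists>\<delta>>0. \<forall>(n::nat) (a::nat \<Rightarrow> real) b.
      (\<forall>k<n. a k \<le> b k \<and> {a k..b k} \<subseteq> S) \<and>
      (\<forall>j<n. \<forall>k<n. j \<noteq> k \<longrightarrow> b j \<le> a k \<or> b k \<le> a j) \<and>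
      (\<Sum>k<n. b k - a k) < \<delta> \<longrightarrow> (\<Sum>k<n. norm (b k - a k)) < e"
    by (intro exI[of _ e]) simp
qed

text \<open>The common source of the closure properties below: sums, products and Lipschitz
  functions all have increments controlled by those of at most two absolutely continuous
  functions.\<close>

lemma abs_cont_on_dominated:
  fixes F :: "real \<Rightarrow> 'a::real_normed_vector" and F1 :: "real \<Rightarrow> 'b::real_normed_vector"
    and F2 :: "real \<Rightarrow> 'c::real_normed_vector"
  assumes F1: "abs_cont_on S F1" and F2: "abs_cont_on S F2"
    and le: "\<And>u v. u \<in> S \<Longrightarrow> v \<in> S \<Longrightarrow> norm (F v - F u) \<le> K * (norm (F1 v - F1 u) + norm (F2 v - F2 u))"
  shows "abs_cont_on S F"
  unfolding abs_cont_on_def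
proof (intro allI impI)
  fix e :: real assume e: "e > 0"
  define L where "L = max K 1"
  define \<eta> where "\<eta> = e / (2 * L)"
  have L: "L > 0" "K \<le> L" by (auto simp: L_def)
  have \<eta>: "\<eta> > 0" using e L by (simp add: \<eta>_def)
  let ?P = "\<lambda>n a b (d::real). (\<forall>k<n::nat. a k \<le> b k \<and> {a k..b k} \<subseteq> S) \<and>
      (\<forall>j<n. \<forall>k<n. j \<noteq> k \<longrightarrow> b j \<le> a k \<or> b k \<le> a j) \<and> (\<Sum>k<n. b k - a k) < d"
  obtain d1 where d1: "d1 > 0" "\<And>n a b. ?P n a b d1 \<Longrightarrow> (\<Sum>k<n. norm (F1 (b k) - F1 (a k))) < \<eta>"
    using F1 \<eta> unfolding abs_cont_on_def by blast
  obtain d2 where d2: "d2 > 0" "\<And>n a b. ?P n a b d2 \<Longrightarrow> (\<Sum>k<n. norm (F2 (b k) - F2 (a k))) < \<eta>"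
    using F2 \<eta> unfolding abs_cont_on_def by blast
  show "\<exists>\<delta>>0. \<forall>n a b. ?P n a b \<delta> \<longrightarrow> (\<Sum>k<n. norm (F (b k) - F (a k))) < e"
  proof (intro exI[of _ "min d1 d2"] conjI allI impI)
    fix n a b assume P: "?P n a b (min d1 d2)"
    have "(\<Sum>k<n. norm (F (b k) - F (a k)))
        \<le> (\<Sum>k<n. L * (norm (F1 (b k) - F1 (a k)) + norm (F2 (b k) - F2 (a k))))"
    proof (rule sum_mono)
      fix k assume "k \<in> {..<n}"
      then have k: "k < n" by simp
      then have "a k \<le> b k" "{a k..b k} \<subseteq> S" using P by blast+
      then have "a k \<in> S" "b k \<in> S" by auto
      from le[OF this] show "norm (F (b k) - F (a k))
          \<le> L * (norm (F1 (b k) - F1 (a k)) + norm (F2 (b k) - F2 (a k)))"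
        using L by (smt (verit) mult_right_mono norm_ge_zero)
    qed
    also have "\<dots> = L * ((\<Sum>k<n. norm (F1 (b k) - F1 (a k))) + (\<Sum>k<n. norm (F2 (b k) - F2 (a k))))"
      by (simp only: sum_distrib_left[symmetric] sum.distrib)
    also have "\<dots> < L * (\<eta> + \<eta>)"
    proof -
      have "?P n a b d1" "?P n a b d2" using P by auto
      then show ?thesis using L d1(2) d2(2) by (intro mult_strict_left_mono add_strict_mono) blast+
    qed
    also have "\<dots> = e" using L by (simp add: \<eta>_def)
    finally show "(\<Sum>k<n. norm (F (b k) - F (a k))) < e" .
  qed (use d1 d2 in auto)
qed

lemma abs_cont_on_add:
  "abs_cont_on S F \<Longrightarrow> abs_cont_on S G \<Longrightarrow> abs_cont_on S (\<lambda>t. F t + G t)"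
  by (rule abs_cont_on_dominated[where K = 1 and ?F1.0 = F and ?F2.0 = G])
    (auto simp: norm_diff_triangle_ineq)

lemma abs_cont_on_inner:
  fixes F G :: "real \<Rightarrow> 'a::real_inner"
  assumes "abs_cont_on S F" "abs_cont_on S G" "bounded (F ` S)" "bounded (G ` S)"
  shows "abs_cont_on S (\<lambda>t. inner (F t) (G t))"
proof -
  obtain A where A: "\<And>t. t \<in> S \<Longrightarrow> norm (F t) \<le> A" using assms(3) unfolding bounded_iff by blast
  obtain B where B: "\<And>t. t \<in> S \<Longrightarrow> norm (G t) \<le> B" using assms(4) unfolding bounded_iff by blast
  show ?thesis
  proof (rule abs_cont_on_dominated[OF assms(1,2), where K = "max A B"])
    fix u v assume uv: "u \<in> S" "v \<in> S"
    have "inner (F v) (G v) - inner (F u) (G u) = inner (F v - F u) (G v) + inner (F u) (G v - G u)"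
      by (simp add: inner_diff_left inner_diff_right)
    also have "norm \<dots> \<le> norm (F v - F u) * norm (G v) + norm (F u) * norm (G v - G u)"
      by (intro norm_triangle_le add_mono) (auto simp: Cauchy_Schwarz_ineq2)
    also have "\<dots> \<le> norm (F v - F u) * max A B + max A B * norm (G v - G u)"
      using A[OF uv(1)] B[OF uv(2)] by (intro add_mono mult_left_mono mult_right_mono) auto
    finally show "norm (inner (F v) (G v) - inner (F u) (G u)) \<le> max A B * (norm (F v - F u) + norm (G v - G u))"
      by (simp add: algebra_simps)
  qed
qed

text \<open>A derivative that is continuous on a compact interval is bounded, so \<open>F\<close> is
  Lipschitz and its increments are dominated by those of the identity.\<close>

lemma abs_cont_on_C1:
  fixes F :: "real \<Rightarrow> 'a::real_normed_vector"
  assumes "continuous_on {a..b} F'"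
    and "\<And>t. t \<in> {a..b} \<Longrightarrow> (F has_vector_derivative F' t) (at t within {a..b})"
  shows "abs_cont_on {a..b} F"
proof -
  have "bounded (F' ` {a..b})"
    by (intro compact_imp_bounded compact_continuous_image assms) auto
  then obtain K where K: "\<And>t. t \<in> {a..b} \<Longrightarrow> norm (F' t) \<le> K" unfolding bounded_iff by blast
  show ?thesis
  proof (rule abs_cont_on_dominated[OF abs_cont_on_ident abs_cont_on_ident, where K = K])
    fix u v assume uv: "u \<in> {a..b}" "v \<in> {a..b}"
    have "norm (F v - F u) \<le> K * norm (v - u)"
      by (rule differentiable_bound[where S = "{a..b}" and f' = "\<lambda>t h. h *\<^sub>R F' t"])
        (use assms(2) K uv in \<open>auto simp: has_vector_derivative_def onorm_scaleR_left bounded_linear_ident onorm_id\<close>)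
    also have "\<dots> \<le> K * (norm (v - u) + norm (v - u))"
      using order_trans[OF norm_ge_zero K[OF uv(1)]] by (intro mult_left_mono) auto
    finally show "norm (F v - F u) \<le> K * (norm (v - u) + norm (v - u))" .
  qed
qed

lemma abs_cont_on_subset:
  assumes F: "abs_cont_on S F" and "T \<subseteq> S"
  shows "abs_cont_on T F"
  unfolding abs_cont_on_def
proof (intro allI impI)
  fix e :: real assume e: "e > 0"
  let ?P = "\<lambda>S n a b (d::real). (\<forall>k<n::nat. a k \<le> b k \<and> {a k..b k} \<subseteq> S) \<and>
      (\<forall>j<n. \<forall>k<n. j \<noteq> k \<longrightarrow> b j \<le> a k \<or> b k \<le> a j) \<and> (\<Sum>k<n. b k - a k) < d"
  obtain d where d: "d > 0" "\<And>n a b. ?P S n a b d \<Longrightarrow> (\<Sum>k<n. norm (F (b k) - F (a k))) < e"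
    using F e unfolding abs_cont_on_def by blast
  show "\<exists>\<delta>>0. \<forall>n a b. ?P T n a b \<delta> \<longrightarrow> (\<Sum>k<n. norm (F (b k) - F (a k))) < e"
  proof (intro exI[of _ d] conjI allI impI)
    fix n a b assume P: "?P T n a b d"
    have "\<forall>k<n. a k \<le> b k \<and> {a k..b k} \<subseteq> S"
      using conjunct1[OF P] \<open>T \<subseteq> S\<close> by (metis subset_trans)
    then show "(\<Sum>k<n. norm (F (b k) - F (a k))) < e"
      using conjunct2[OF P] by (intro d(2) conjI) blast+
  qed (rule d(1))
qed

lemma abs_cont_on_scaleR:
  "abs_cont_on S F \<Longrightarrow> abs_cont_on S (\<lambda>t. c *\<^sub>R F t)"
  by (rule abs_cont_on_dominated[where K = "\<bar>c\<bar>" and ?F1.0 = F and ?F2.0 = F])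
    (auto simp: scaleR_diff_right[symmetric] mult_left_mono)

lemma abs_cont_on_C1_real:
  assumes "continuous_on {a..b} F'"
    and "\<And>t. t \<in> {a..b} \<Longrightarrow> (F has_real_derivative F' t) (at t within {a..b})"
  shows "abs_cont_on {a..b} F"
  using assms by (intro abs_cont_on_C1[of a b F']) (auto simp: has_real_derivative_iff_has_vector_derivative)

section \<open>Merit functions and regularized minimizers\<close>

lemma convex_sublevel:
  fixes h :: "'a::real_vector \<Rightarrow> real"
  assumes "convex_on S h"
  shows "convex {z \<in> S. h z \<le> c}"
proof (rule convexI)
  fix y z :: 'a and u v :: real
  assume yz: "y \<in> {z \<in> S. h z \<le> c}" "z \<in> {z \<in> S. h z \<le> c}" and uv: "0 \<le> u" "0 \<le> v" "u + v = 1"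
  have "h (u *\<^sub>R y + v *\<^sub>R z) \<le> u * h y + v * h z"
    using assms yz uv unfolding convex_on_def by blast
  also have "\<dots> \<le> c" using yz uv by (intro convex_bound_le) auto
  finally show "u *\<^sub>R y + v *\<^sub>R z \<in> {z \<in> S. h z \<le> c}"
    using convexD[OF convex_on_imp_convex[OF assms], of y z u v] yz uv by auto
qed

lemma Max_range_add_const:
  fixes h :: "'m::finite \<Rightarrow> real"
  shows "Max (range (\<lambda>i. h i + c)) = Max (range h) + c"
  using Max_add_commute[of UNIV h c] by simp

lemma Min_range_diff_eq:
  fixes a b :: "'m::finite \<Rightarrow> real"
  shows "Min (range (\<lambda>i. a i - b i)) = - Max (range (\<lambda>i. b i - a i))"
  using minus_Max_eq_Min[of "range (\<lambda>i. b i - a i)"] by (simp add: image_image)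

text \<open>The supremum of the minima is the negated infimum of the maxima, here attained at
  \<open>z\<close>. Attainment is what makes the real-valued \<open>SUP\<close> in
  \<open>merit\<close> meaningful. The competitor \<open>u = y\<close> gives nonnegativity.\<close>

lemma merit_eq_at_argmin:
  fixes h :: "'m::finite \<Rightarrow> 'a \<Rightarrow> real"
  assumes "\<And>u. Max (range (\<lambda>i. h i z - h i y)) \<le> Max (range (\<lambda>i. h i u - h i y))"
  shows "merit h y = Min (range (\<lambda>i. h i y - h i z))" "merit h y \<ge> 0"
proof -
  have "Min (range (\<lambda>i. h i y - h i u)) \<le> Min (range (\<lambda>i. h i y - h i z))" for u
    unfolding Min_range_diff_eq using assms[of u] by (rule le_imp_neg_le)
  then show eq: "merit h y = Min (range (\<lambda>i. h i y - h i z))"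
    unfolding merit_def by (intro cSup_eq_maximum) auto
  show "merit h y \<ge> 0"
    unfolding eq Min_range_diff_eq using assms[of y] by simp
qed

section \<open>Bounds and minimizers for convex objectives under (A4)\<close>

locale convex_objectives =
  fixes f :: "'m::finite \<Rightarrow> 'a::{real_inner,complete_space} \<Rightarrow> real"
    and g :: "'m \<Rightarrow> 'a \<Rightarrow> 'a"
  assumes convex: "\<And>i. convex_on UNIV (f i)"
    and grad: "\<And>i y. (f i has_derivative (\<lambda>h. inner (g i y) h)) (at y)"
    and lipschitz: "\<And>i. \<exists>L. \<forall>y u. norm (g i y - g i u) \<le> L * norm (y - u)"
    and Sset_nonempty: "\<And>w. Sset f w \<noteq> {}"
    and proj_Sset_continuous: "continuous_on UNIV (\<lambda>w. proj (Sset f w) 0)"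
begin

lemma continuous_on_f: "continuous_on S (f i)"
  by (intro continuous_at_imp_continuous_on ballI has_derivative_continuous[OF grad])

lemma continuous_on_g: "continuous_on S (g i)"
proof -
  obtain L where L: "\<And>y u. norm (g i y - g i u) \<le> L * norm (y - u)" using lipschitz by blast
  have "(max L 0)-lipschitz_on S (g i)"
  proof (rule lipschitz_onI)
    fix y u
    show "dist (g i y) (g i u) \<le> max L 0 * dist y u"
      using L[of y u] by (smt (verit) dist_norm mult_right_mono norm_ge_zero)
  qed simp
  then show ?thesis by (rule lipschitz_on_continuous_on)
qed

lemma gradient_ineq: "f i y + inner (g i y) (z - y) \<le> f i z"
  by (rule convex_gradient_ineq[OF convex grad])

lemma f_lower_bound: "norm z \<le> R \<Longrightarrow> f i 0 - norm (g i 0) * R \<le> f i z"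
  using gradient_ineq[of i 0 z] Cauchy_Schwarz_ineq2[of "g i 0" z]
    mult_left_mono[of "norm z" R "norm (g i 0)"] by (simp add: abs_le_iff)

text \<open>Bounded sets need not be relatively compact in a Hilbert space, so continuity does not
  suffice. The Lipschitz gradient grows at most linearly, which bounds \<open>f i\<close> above
  through the tangent at \<open>y\<close>; the tangent at 0 bounds it below.\<close>

lemma f_bounded:
  assumes "bounded S"
  shows "bounded (f i ` S)"
proof -
  obtain R where R: "\<And>y. y \<in> S \<Longrightarrow> norm y \<le> R" using assms unfolding bounded_iff by blast
  obtain L where L: "\<And>y u. norm (g i y - g i u) \<le> L * norm (y - u)" using lipschitz by blast
  define C where "C = \<bar>f i 0\<bar> + (norm (g i 0) + \<bar>L\<bar> * R) * R"
  have "\<bar>f i y\<bar> \<le> C" if y: "y \<in> S" for y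
  proof -
    have "norm (g i y) \<le> norm (g i 0) + norm (g i y - g i 0)" by (rule norm_triangle_sub)
    also have "\<dots> \<le> norm (g i 0) + \<bar>L\<bar> * R"
    proof -
      have "L * norm y \<le> \<bar>L\<bar> * R"
        using R[OF y] by (intro mult_mono) auto
      then show ?thesis using L[of y 0] by simp
    qed
    finally have gy: "norm (g i y) \<le> norm (g i 0) + \<bar>L\<bar> * R" .
    have R0: "R \<ge> 0" using R[OF y] norm_ge_zero order_trans by blast
    have "f i y \<le> f i 0 + norm (g i y) * norm y"
      using gradient_ineq[of i y 0] Cauchy_Schwarz_ineq2[of "g i y" y] by (simp add: abs_le_iff)
    also have "norm (g i y) * norm y \<le> (norm (g i 0) + \<bar>L\<bar> * R) * R"
      using gy R[OF y] R0 by (intro mult_mono) auto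
    finally have "f i y \<le> C" by (simp add: C_def)
    moreover have "f i 0 - norm (g i 0) * R \<le> f i y" by (rule f_lower_bound[OF R[OF y]])
    moreover have "norm (g i 0) * R \<le> (norm (g i 0) + \<bar>L\<bar> * R) * R"
      using R0 by (intro mult_right_mono) auto
    ultimately show ?thesis unfolding C_def by linarith
  qed
  then show ?thesis unfolding bounded_iff by auto
qed

lemma convex_on_Max_f: "convex_on UNIV (\<lambda>z. Max (range (\<lambda>i. f i z - c i)))"
proof (rule convex_on_Max)
  show "convex_on UNIV (\<lambda>z. f i z - c i)" for i
    using convex_on_add[OF convex[of i], of "\<lambda>_. - c i"] by (simp add: convex_on_const)
qed

lemma continuous_on_Max_f: "continuous_on S (\<lambda>z. Max (range (\<lambda>i. f i z - c i)))"
  by (intro continuous_on_Max continuous_intros continuous_on_f)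

text \<open>The set of minimizers is an intersection of sublevel sets of one continuous convex
  function, hence closed and convex, so its least-norm element exists.\<close>

lemma proj_Sset:
  shows "proj (Sset f w) 0 \<in> Sset f w"
proof (rule proj_mem_le(1))
  have eq: "Sset f w = (\<Inter>u. {z \<in> UNIV. Max (range (\<lambda>i. f i z - w $ i)) \<le> Max (range (\<lambda>i. f i u - w $ i))})"
    by (auto simp: Sset_def)
  show "convex (Sset f w)"
    unfolding eq by (intro convex_INT convex_sublevel convex_on_Max_f)
  show "closed (Sset f w)"
    unfolding eq
    by (intro closed_INT ballI)
      (simp only: UNIV_I simp_thms closed_Collect_le[OF continuous_on_Max_f continuous_on_const])
  show "Sset f w \<noteq> {}" by (rule Sset_nonempty)
qed

text \<open>The unregularized counterpart of \<open>zreg\<close>, made available by (A4). It serves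
  as a competitor in the regularized problem, and its norm bounds that of
  \<open>zreg\<close>.\<close>

abbreviation proj_minimizer :: "'a \<Rightarrow> 'a" where
  "proj_minimizer y \<equiv> proj (Sset f (Fvec f y)) 0"

lemma proj_minimizer_argmin:
  "Max (range (\<lambda>i. f i (proj_minimizer y) - f i y)) \<le> Max (range (\<lambda>i. f i u - f i y))"
  using proj_Sset[of "Fvec f y"] by (simp add: Sset_def Fvec_def)

text \<open>The map factors through the finite-dimensional space of objective values. There the
  image of a bounded set has compact closure, and the continuity in (A4) carries compactness over to
  the least-norm minimizers.\<close>

lemma proj_minimizer_bounded:
  assumes "bounded S"
  shows "bounded (proj_minimizer ` S)"
proof -
  have "bounded (Fvec f ` S)"
  proof -
    have "\<exists>B. \<forall>y\<in>S. \<bar>f i y\<bar> \<le> B" for i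
      using f_bounded[OF assms, of i] unfolding bounded_iff by simp
    then obtain B where B: "\<And>i y. y \<in> S \<Longrightarrow> \<bar>f i y\<bar> \<le> B i" by metis
    have "norm (Fvec f y) \<le> (\<Sum>i\<in>UNIV. B i)" if "y \<in> S" for y
      using norm_le_l1_cart[of "Fvec f y"] sum_mono[of UNIV "\<lambda>i. \<bar>f i y\<bar>" B] B[OF that]
      by (simp add: Fvec_def)
    then show ?thesis unfolding bounded_iff by auto
  qed
  then have "compact (closure (Fvec f ` S))" by simp
  then have "bounded ((\<lambda>w. proj (Sset f w) 0) ` closure (Fvec f ` S))"
    by (intro compact_imp_bounded compact_continuous_image continuous_on_subset[OF proj_Sset_continuous]) auto
  then show ?thesis
    by (rule bounded_subset) (use closure_subset in force)
qed

text \<open>The regularization is the same in every component, so it leaves the maximum. What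
  remains is a convex function plus a positive multiple of the squared norm.\<close>

lemma Max_freg_diff:
  "Max (range (\<lambda>i. freg f \<beta> p t i u - freg f \<beta> p t i y))
    = Max (range (\<lambda>i. f i u - f i y)) + \<beta> / (2 * t powr p) * (norm u)\<^sup>2 - \<beta> / (2 * t powr p) * (norm y)\<^sup>2"
  using Max_range_add_const[of "\<lambda>i. f i u - f i y" "\<beta> / (2 * t powr p) * (norm u)\<^sup>2 - \<beta> / (2 * t powr p) * (norm y)\<^sup>2"]
  by (simp add: freg_def algebra_simps)

text \<open>Strong convexity makes the definite description in \<open>zreg\<close> well defined. The
  lower bound that the existence lemma asks for is the unregularized minimum, attained at
  \<open>proj_minimizer y\<close>.\<close>

lemma zreg_argmin:
  assumes "\<beta> > 0" "t > 0"
  shows "Max (range (\<lambda>i. freg f \<beta> p t i (zreg f \<beta> p t y) - freg f \<beta> p t i y))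
    \<le> Max (range (\<lambda>i. freg f \<beta> p t i u - freg f \<beta> p t i y))"
proof -
  have "\<exists>!z. z \<in> UNIV \<and> (\<forall>u\<in>UNIV. Max (range (\<lambda>i. f i z - f i y)) + \<beta> / (2 * t powr p) * (norm z)\<^sup>2
      \<le> Max (range (\<lambda>i. f i u - f i y)) + \<beta> / (2 * t powr p) * (norm u)\<^sup>2)"
    by (rule ex1_argmin_convex_plus_sq_norm[OF _ _ _ convex_on_Max_f continuous_on_Max_f
          proj_minimizer_argmin[of y]]) (use assms in auto)
  then have "\<exists>!z. \<forall>u. Max (range (\<lambda>i. freg f \<beta> p t i z - freg f \<beta> p t i y))
                            \<le> Max (range (\<lambda>i. freg f \<beta> p t i u - freg f \<beta> p t i y))"
    by (simp add: Max_freg_diff)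
  from theI'[OF this] show ?thesis unfolding zreg_def by blast
qed

text \<open>The usual Tikhonov comparison: adding the two minimality inequalities, each tested with
  the other minimizer, cancels the objective parts and leaves only the squared norms.\<close>

lemma norm_zreg_le:
  assumes "\<beta> > 0" "t > 0"
  shows "norm (zreg f \<beta> p t y) \<le> norm (proj_minimizer y)"
proof -
  have "\<beta> / (2 * t powr p) * (norm (zreg f \<beta> p t y))\<^sup>2 \<le> \<beta> / (2 * t powr p) * (norm (proj_minimizer y))\<^sup>2"
    using zreg_argmin[OF assms, of p y "proj_minimizer y"] proj_minimizer_argmin[of y "zreg f \<beta> p t y"]
    unfolding Max_freg_diff by linarith
  moreover have "\<beta> / (2 * t powr p) > 0" using assms by simp
  ultimately have "(norm (zreg f \<beta> p t y))\<^sup>2 \<le> (norm (proj_minimizer y))\<^sup>2"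
    using mult_le_cancel_left_pos by blast
  then show ?thesis by (rule power2_le_imp_le) simp
qed

text \<open>Testing the regularized problem with the unregularized minimizer costs only its
  regularization term; the term in \<open>norm y\<close> has the favourable sign.\<close>

lemma merit_le_merit_freg:
  assumes "\<beta> > 0" "t > 0"
  shows "merit f y \<le> merit (freg f \<beta> p t) y + \<beta> / (2 * t powr p) * (norm (proj_minimizer y))\<^sup>2"
proof -
  have "merit f y = - Max (range (\<lambda>i. f i (proj_minimizer y) - f i y))"
    using merit_eq_at_argmin(1)[where h = f and y = y, OF proj_minimizer_argmin] by (simp add: Min_range_diff_eq)
  moreover have "merit (freg f \<beta> p t) y
      = - Max (range (\<lambda>i. freg f \<beta> p t i (zreg f \<beta> p t y) - freg f \<beta> p t i y))"
    using merit_eq_at_argmin(1)[where h = "freg f \<beta> p t" and y = y, OF zreg_argmin[OF assms]] by (simp add: Min_range_diff_eq)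
  moreover have "\<beta> / (2 * t powr p) * (norm y)\<^sup>2 \<ge> 0" using assms by simp
  ultimately show ?thesis
    using zreg_argmin[OF assms, of p y "proj_minimizer y"] unfolding Max_freg_diff[of _ _ _ "proj_minimizer y"]
    by linarith
qed

end

section \<open>Decay of the frozen Lyapunov function\<close>

text \<open>Here \<open>h\<close> plays the role of \<open>\<parallel>x - z\<parallel>\<^sup>2 / 2\<close> for a frozen comparison point \<open>z\<close>, \<open>e\<close> that of
  \<open>\<parallel>x'\<parallel>\<^sup>2\<close>, and \<open>G\<close> that of the value gap plus the dissipation still to come.\<close>

lemma damped_rate_estimate:
  fixes h h' e G :: "real \<Rightarrow> real"
  assumes t1: "0 < t1" "t1 \<le> T" and q: "0 < q" "q < 1" "2 * q < p" and \<alpha>: "0 < \<alpha>" and C: "0 \<le> C"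
    and large: "\<And>t. t1 \<le> t \<Longrightarrow> 3 * q * t powr (2 * q - 1) \<le> \<alpha> * t powr q"
    and h: "\<And>t. t \<in> {t1..T} \<Longrightarrow> (h has_real_derivative h' t) (at t within {t1..T})"
    and h_bounds: "\<And>t. t \<in> {t1..T} \<Longrightarrow> 0 \<le> h t" "\<And>t. t \<in> {t1..T} \<Longrightarrow> h t \<le> M"
    and h': "continuous_on {t1..T} h'" "abs_cont_on {t1..T} h'"
    and e: "continuous_on {t1..T} e" "\<And>t. 0 \<le> e t"
    and G: "\<And>t. t \<in> {t1..T} \<Longrightarrow> (G has_real_derivative - (\<alpha> * t powr (- q) * e t)) (at t within {t1..T})"
    and ode: "AE t in lborel. t \<in> {t1<..<T} \<longrightarrow> (\<exists>h2. (h' has_real_derivative h2) (at t) \<and>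
        h2 \<le> 3 / 2 * e t + C * t powr (- p) - \<alpha> * t powr (- q) * h' t - G t)"
  shows "T powr (2 * q) * G T + 2 * q * T powr (2 * q - 1) * h' T
    \<le> t1 powr (2 * q) * G t1 + 2 * q * t1 powr (2 * q - 1) * h' t1 + 2 * q * \<alpha> * t1 powr (q - 1) * M
      + 2 * q * C / (p - 2 * q) * t1 powr (2 * q - p) + 4 * q * \<bar>2 * q - 1\<bar> * M * t1 powr (2 * q - 2)"
proof -
  \<comment> \<open>\<open>A\<close> is chosen so that the derivative of
    \<open>A * t powr (2 * q - p)\<close> cancels the error
    \<open>2 * q * C * t powr (2 * q - p - 1)\<close>; it is nonnegative because
    \<open>2 * q < p\<close>. \<open>B\<close> is chosen to dominate the term in \<open>h\<close>
    whose sign depends on \<open>2 * q - 1\<close>.\<close>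
  define A where "A = 2 * q * C / (p - 2 * q)"
  define B where "B = 2 * q * \<bar>2 * q - 1\<bar> * M"
  have M: "0 \<le> M" using h_bounds[of T] t1 by (smt (verit) atLeastAtMost_iff)
  have "A * (p - 2 * q) = 2 * q * C" using q by (simp add: A_def)
  then have A: "0 \<le> A" "A * (2 * q - p) = - (2 * q * C)"
    using q C by (simp add: A_def, simp add: right_diff_distrib)
  \<comment> \<open>The Lyapunov function arises by multiplying the inequality for \<open>h2\<close>
    by \<open>2 * q * t powr (2 * q - 1)\<close>. The terms in \<open>G\<close> then cancel against
    the derivative of \<open>t powr (2 * q) * G t\<close>, and the two multiples of \<open>h\<close>
    absorb the terms in \<open>h'\<close>. \<open>\<Psi>1\<close> collects the continuously
    differentiable summands; the one containing \<open>h'\<close>, which is only absolutely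
    continuous, is added in \<open>\<Psi>\<close>.\<close>
  define \<Psi>1 where "\<Psi>1 t = t powr (2 * q) * G t + (2 * q * \<alpha>) * (t powr (q - 1) * h t)
    + (- (2 * q * (2 * q - 1))) * (t powr (2 * q - 2) * h t) + A * t powr (2 * q - p) + B * t powr (2 * q - 2)" for t
  define \<Psi>1' where "\<Psi>1' t = (2 * q * t powr (2 * q - 1) * G t + - (\<alpha> * t powr (- q) * e t) * t powr (2 * q))
    + (2 * q * \<alpha>) * ((q - 1) * t powr (q - 1 - 1) * h t + h' t * t powr (q - 1))
    + (- (2 * q * (2 * q - 1))) * ((2 * q - 2) * t powr (2 * q - 2 - 1) * h t + h' t * t powr (2 * q - 2))
    + A * ((2 * q - p) * t powr (2 * q - p - 1)) + B * ((2 * q - 2) * t powr (2 * q - 2 - 1))" for t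
  define \<Psi> where "\<Psi> t = \<Psi>1 t + (2 * q) * (t powr (2 * q - 1) * h' t)" for t
  have pw: "((\<lambda>t. t powr a) has_real_derivative a * t powr (a - 1)) (at t within {t1..T})"
    if "t \<in> {t1..T}" for a t
    by (rule has_field_derivative_at_within[OF has_real_derivative_powr]) (use that t1 in auto)
  have \<Psi>1: "(\<Psi>1 has_real_derivative \<Psi>1' t) (at t within {t1..T})" if t: "t \<in> {t1..T}" for t
    unfolding \<Psi>1_def \<Psi>1'_def
    by (intro DERIV_add DERIV_mult DERIV_cmult pw[OF t] h[OF t] G[OF t])
  have nz: "t \<noteq> 0" if "t \<in> {t1..T}" for t using that t1 by auto
  have cont_h: "continuous_on {t1..T} h" by (rule DERIV_continuous_on[OF h])
  have cont_G: "continuous_on {t1..T} G" by (rule DERIV_continuous_on[OF G])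
  have "continuous_on {t1..T} \<Psi>1'"
    unfolding \<Psi>1'_def by (intro continuous_intros cont_h cont_G h'(1) e(1)) (auto dest: nz)
  then have "abs_cont_on {t1..T} \<Psi>1" using \<Psi>1 by (rule abs_cont_on_C1_real)
  moreover have "abs_cont_on {t1..T} (\<lambda>t. (2 * q) *\<^sub>R inner (t powr (2 * q - 1)) (h' t))"
  proof (intro abs_cont_on_scaleR abs_cont_on_inner h'(2))
    show "abs_cont_on {t1..T} (\<lambda>t. t powr (2 * q - 1))"
      by (rule abs_cont_on_C1_real[OF _ pw]) (auto intro!: continuous_intros dest: nz)
    show "bounded ((\<lambda>t. t powr (2 * q - 1)) ` {t1..T})" "bounded (h' ` {t1..T})"
      by (intro compact_imp_bounded compact_continuous_image continuous_intros h'(1); auto dest: nz)+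
  qed
  ultimately have ac: "abs_cont_on {t1..T} \<Psi>"
    unfolding \<Psi>_def using abs_cont_on_add by fastforce
  have "\<Psi> T \<le> \<Psi> t1"
  proof (rule abs_cont_on_nonincreasing[OF t1(2) ac])
    from ode show "AE t in lborel. t \<in> {t1<..<T} \<longrightarrow> (\<exists>D\<le>0. (\<Psi> has_real_derivative D) (at t))"
    proof eventually_elim
      case (elim t)
      show ?case
      proof
        assume tin: "t \<in> {t1<..<T}"
        then have t: "t \<in> {t1..T}" "t > 0" and at: "at t within {t1..T} = at t"
          using t1 by (auto simp: at_within_Icc_at)
        obtain h2 where h2: "(h' has_real_derivative h2) (at t)"
          "h2 \<le> 3 / 2 * e t + C * t powr (- p) - \<alpha> * t powr (- q) * h' t - G t"
          using elim tin by blast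
        define D where "D = \<Psi>1' t + (2 * q) * ((2 * q - 1) * t powr (2 * q - 1 - 1) * h' t + h2 * t powr (2 * q - 1))"
        have "(\<Psi> has_real_derivative D) (at t)"
          unfolding \<Psi>_def D_def
          by (intro DERIV_add DERIV_mult DERIV_cmult h2(1) \<Psi>1[OF t(1), unfolded at] pw[OF t(1), unfolded at])
        moreover have "D \<le> 0"
        proof -
          have e1: "t powr (2 * q) = t powr q * t powr q" "t powr (- q) * t powr q = 1"
            "t powr (2 * q - 1) * t powr (- q) = t powr (q - 1)"
            "t powr (2 * q - 1) * t powr (- p) = t powr (2 * q - p - 1)"
            using t(2) by (simp_all add: powr_add[symmetric] algebra_simps)
          have "h2 * t powr (2 * q - 1)
            \<le> (3 / 2 * e t + C * t powr (- p) - \<alpha> * t powr (- q) * h' t - G t) * t powr (2 * q - 1)"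
            using h2(2) by (intro mult_right_mono) auto
          also have "\<dots> = 3 / 2 * (t powr (2 * q - 1) * e t) + C * (t powr (2 * q - 1) * t powr (- p))
              - \<alpha> * (t powr (2 * q - 1) * t powr (- q)) * h' t - t powr (2 * q - 1) * G t"
            by (simp add: algebra_simps)
          also have "\<dots> = 3 / 2 * (t powr (2 * q - 1) * e t) + C * t powr (2 * q - p - 1)
              - \<alpha> * t powr (q - 1) * h' t - t powr (2 * q - 1) * G t"
            by (simp only: e1)
          finally have h2': "2 * q * (h2 * t powr (2 * q - 1))
            \<le> 2 * q * (3 / 2 * (t powr (2 * q - 1) * e t) + C * t powr (2 * q - p - 1)
              - \<alpha> * t powr (q - 1) * h' t - t powr (2 * q - 1) * G t)"
            using q by (intro mult_left_mono) auto
          have diss: "- (\<alpha> * t powr (- q) * e t) * t powr (2 * q) = - (\<alpha> * t powr q * e t)"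
            using e1(1,2) by (simp add: algebra_simps)
          note h2'
          moreover have "A * ((2 * q - p) * t powr (2 * q - p - 1)) = - (2 * q * C) * t powr (2 * q - p - 1)"
            using A(2) by (metis mult.assoc)
          \<comment> \<open>After the cancellations three groups are left: the one in
            \<open>e\<close> is nonpositive because damping dominates for large \<open>t\<close>,
            the second because \<open>q < 1\<close>, and the third by the choice of
            \<open>B\<close>.\<close>
          ultimately have "D \<le> (3 * q * t powr (2 * q - 1) - \<alpha> * t powr q) * e t
              + 2 * q * \<alpha> * ((q - 1) * (t powr (q - 2) * h t))
              + 2 * q * ((2 * q - 2) * (t powr (2 * q - 3) * (\<bar>2 * q - 1\<bar> * M - (2 * q - 1) * h t)))"
            unfolding D_def \<Psi>1'_def B_def diss by (simp add: algebra_simps)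
          moreover have "(3 * q * t powr (2 * q - 1) - \<alpha> * t powr q) * e t \<le> 0"
            using large[of t] t(1) e(2)[of t] by (intro mult_nonpos_nonneg) auto
          moreover have "2 * q * \<alpha> * ((q - 1) * (t powr (q - 2) * h t)) \<le> 0"
            using q \<alpha> h_bounds(1)[OF t(1)] by (intro mult_nonneg_nonpos mult_nonpos_nonneg) auto
          moreover have "(2 * q - 1) * h t \<le> \<bar>2 * q - 1\<bar> * M"
            using h_bounds[OF t(1)] by (intro mult_mono) auto
          then have "2 * q * ((2 * q - 2) * (t powr (2 * q - 3) * (\<bar>2 * q - 1\<bar> * M - (2 * q - 1) * h t))) \<le> 0"
            using q by (intro mult_nonneg_nonpos mult_nonpos_nonneg) auto
          ultimately show ?thesis by linarith
        qed
        ultimately show "\<exists>D\<le>0. (\<Psi> has_real_derivative D) (at t)" by blast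
      qed
    qed
  qed
  moreover have "T powr (2 * q) * G T + 2 * q * T powr (2 * q - 1) * h' T \<le> \<Psi> T"
  proof -
    have T: "T \<in> {t1..T}" using t1 by simp
    have "(2 * q - 1) * h T \<le> \<bar>2 * q - 1\<bar> * M"
      using h_bounds[OF T] by (intro mult_mono) auto
    then have "0 \<le> 2 * q * T powr (2 * q - 2) * (\<bar>2 * q - 1\<bar> * M - (2 * q - 1) * h T)"
      using q by (intro mult_nonneg_nonneg) auto
    moreover have "0 \<le> 2 * q * \<alpha> * (T powr (q - 1) * h T)" "0 \<le> A * T powr (2 * q - p)"
      using q \<alpha> A h_bounds(1)[OF T] by auto
    ultimately show ?thesis
      unfolding \<Psi>_def \<Psi>1_def B_def by (simp add: algebra_simps)
  qed
  moreover have "\<Psi> t1 \<le> t1 powr (2 * q) * G t1 + 2 * q * t1 powr (2 * q - 1) * h' t1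
      + 2 * q * \<alpha> * t1 powr (q - 1) * M + A * t1 powr (2 * q - p) + 2 * B * t1 powr (2 * q - 2)"
  proof -
    have T: "t1 \<in> {t1..T}" using t1 by simp
    have "- (2 * q - 1) * h t1 \<le> \<bar>2 * q - 1\<bar> * M"
      using h_bounds[OF T] by (intro mult_mono) linarith+
    then have "0 \<le> \<bar>2 * q - 1\<bar> * M + (2 * q - 1) * h t1" by (simp only: mult_minus_left)
    then have "0 \<le> 2 * q * t1 powr (2 * q - 2) * (\<bar>2 * q - 1\<bar> * M + (2 * q - 1) * h t1)"
      using q by (intro mult_nonneg_nonneg) simp_all
    moreover have "2 * q * \<alpha> * t1 powr (q - 1) * h t1 \<le> 2 * q * \<alpha> * t1 powr (q - 1) * M"
      using q \<alpha> h_bounds(2)[OF T] by (intro mult_left_mono) auto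
    ultimately show ?thesis
      unfolding \<Psi>_def \<Psi>1_def B_def by (simp add: algebra_simps)
  qed
  ultimately show ?thesis unfolding A_def B_def by (simp add: algebra_simps)
qed

section \<open>Trajectories\<close>

lemma has_real_derivative_inner:
  fixes u v :: "real \<Rightarrow> 'a::real_inner"
  assumes "(u has_vector_derivative u') (at t within S)" "(v has_vector_derivative v') (at t within S)"
  shows "((\<lambda>t. inner (u t) (v t)) has_real_derivative inner (u t) v' + inner u' (v t)) (at t within S)"
  using bounded_bilinear.has_vector_derivative[OF bounded_bilinear_inner assms]
  by (simp add: has_real_derivative_iff_has_vector_derivative)

locale mtrigs_trajectory = convex_objectives f g
  for f :: "'m::finite \<Rightarrow> 'a::{real_inner,complete_space} \<Rightarrow> real" and g :: "'m \<Rightarrow> 'a \<Rightarrow> 'a" +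
  fixes t0 \<alpha> \<beta> q p :: real and x0 v0 :: 'a and x x' x'' :: "real \<Rightarrow> 'a"
  assumes t0: "t0 > 0" and \<alpha>: "\<alpha> > 0" and \<beta>: "\<beta> > 0"
    and q: "0 < q" "q < 1" and p: "2 * q < p"
    and sol: "mtrigs_solution f g t0 \<alpha> \<beta> q p x0 v0 x x' x''"
    and bdd: "bounded (x ` {t0..})"
begin

lemma freg_eq: "freg f \<beta> p t i y = f i y + \<beta> / 2 * (t powr (- p) * (norm y)\<^sup>2)"
  by (simp add: freg_def powr_minus divide_simps)

lemma f_le_freg: "f i y \<le> freg f \<beta> p t i y"
  using \<beta> by (simp add: freg_eq)

lemma x_deriv: "t0 \<le> a \<Longrightarrow> t \<in> {a..b} \<Longrightarrow> (x has_vector_derivative x' t) (at t within {a..b})"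
  using sol unfolding mtrigs_solution_def
  by (meson atLeastAtMost_iff atLeast_iff has_vector_derivative_within_subset order_trans subsetI)

lemma continuous_on_x': "S \<subseteq> {t0..} \<Longrightarrow> continuous_on S x'"
  using sol unfolding mtrigs_solution_def by (meson continuous_on_subset)

lemma continuous_on_x: "t0 \<le> a \<Longrightarrow> continuous_on {a..b} x"
  using x_deriv by (meson continuous_on_vector_derivative)

lemma abs_cont_x': "t0 \<le> a \<Longrightarrow> a \<le> b \<Longrightarrow> abs_cont_on {a..b} x'"
proof -
  assume ab: "t0 \<le> a" "a \<le> b"
  then have "abs_cont_on {t0..b} x'" using sol unfolding mtrigs_solution_def by auto
  then show ?thesis by (rule abs_cont_on_subset) (use ab in auto)
qed

text \<open>The equation says that the projection equals
  \<open>- (\<alpha> * t powr (- q)) *\<^sub>R x' t\<close>. Its membership in the translated hull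
  yields a second-order equation with some convex combination \<open>c\<close> of gradients. The
  variational inequality tested at each vertex yields one inequality per objective.\<close>

lemma dynamics:
  "AE t in lborel. t \<ge> t0 \<longrightarrow> (x' has_vector_derivative x'' t) (at t) \<and>
    (\<exists>c \<in> convex hull (range (\<lambda>i. g i (x t))).
        x'' t = - c - (\<beta> * t powr (- p)) *\<^sub>R x t - (\<alpha> * t powr (- q)) *\<^sub>R x' t) \<and>
    (\<forall>i. inner (x' t) (g i (x t) + (\<beta> * t powr (- p)) *\<^sub>R x t + x'' t + (\<alpha> * t powr (- q)) *\<^sub>R x' t) \<le> 0)"
proof -
  have "AE t in lborel. t \<ge> t0 \<longrightarrow>
        (x' has_vector_derivative x'' t) (at t) \<and>
        (\<alpha> / t powr q) *\<^sub>R x' t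
          + proj ((\<lambda>c. c + (\<beta> / t powr p) *\<^sub>R x t + x'' t) ` (convex hull (range (\<lambda>i. g i (x t))))) 0
          = 0"
    using sol unfolding mtrigs_solution_def by blast
  then show ?thesis
  proof eventually_elim
    case (elim t)
    show ?case
    proof
      assume t: "t \<ge> t0"
      define a where "a = \<alpha> * t powr (- q)"
      define d where "d = (\<beta> * t powr (- p)) *\<^sub>R x t + x'' t"
      define H where "H = convex hull (range (\<lambda>i. g i (x t)))"
      define u where "u = proj ((+) d ` H) 0"
      have a: "a > 0" using \<alpha> t t0 by (simp add: a_def)
      have "(\<lambda>c. c + (\<beta> / t powr p) *\<^sub>R x t + x'' t) ` H = (+) d ` H"
        by (auto simp: d_def powr_minus divide_simps add_ac image_iff)
      then have u: "a *\<^sub>R x' t + u = 0" and der: "(x' has_vector_derivative x'' t) (at t)"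
        using elim t unfolding H_def u_def a_def by (auto simp: powr_minus divide_inverse)
      have cvx: "convex ((+) d ` H)" unfolding H_def by (intro convex_translation convex_convex_hull)
      have cl: "closed ((+) d ` H)"
        unfolding H_def
        by (intro compact_imp_closed compact_translation finite_imp_compact_convex_hull) simp
      have gH: "g i (x t) \<in> H" for i unfolding H_def by (rule hull_inc) simp
      have "u \<in> (+) d ` H"
        unfolding u_def by (rule proj_mem_le(1)[OF cvx cl]) (use gH in blast)
      then obtain c where c: "c \<in> H" "u = d + c" by blast
      have "x'' t = - c - (\<beta> * t powr (- p)) *\<^sub>R x t - a *\<^sub>R x' t"
        using u unfolding c(2) d_def by (simp add: algebra_simps eq_neg_iff_add_eq_0)
      moreover have "inner (x' t) (g i (x t) + (\<beta> * t powr (- p)) *\<^sub>R x t + x'' t + a *\<^sub>R x' t) \<le> 0" for i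
      proof -
        have "inner u ((d + g i (x t)) - u) \<ge> 0"
          unfolding u_def using gH by (intro proj_variational_inequality cvx cl) blast
        moreover have "u = - (a *\<^sub>R x' t)" using u by (simp add: eq_neg_iff_add_eq_0 add.commute)
        ultimately have "a * inner (x' t) (d + g i (x t) + a *\<^sub>R x' t) \<le> 0" by simp
        then show ?thesis using a by (simp add: d_def mult_le_0_iff add_ac)
      qed
      ultimately show "(x' has_vector_derivative x'' t) (at t) \<and>
        (\<exists>c \<in> convex hull (range (\<lambda>i. g i (x t))).
          x'' t = - c - (\<beta> * t powr (- p)) *\<^sub>R x t - (\<alpha> * t powr (- q)) *\<^sub>R x' t) \<and>
        (\<forall>i. inner (x' t) (g i (x t) + (\<beta> * t powr (- p)) *\<^sub>R x t + x'' t + (\<alpha> * t powr (- q)) *\<^sub>R x' t) \<le> 0)"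
        using der c(1) unfolding H_def a_def by blast
    qed
  qed
qed

section \<open>Energy balance for each single objective\<close>

definition dissipation :: "real \<Rightarrow> real" where
  "dissipation t = integral {t0..t} (\<lambda>s. \<alpha> * s powr (- q) * (norm (x' s))\<^sup>2)"

lemma continuous_on_dissipation_rate:
  "t0 \<le> a \<Longrightarrow> continuous_on {a..b} (\<lambda>s. \<alpha> * s powr (- q) * (norm (x' s))\<^sup>2)"
  using t0 by (intro continuous_intros continuous_on_x') auto

lemma dissipation_deriv:
  assumes "t0 \<le> a" "t \<in> {a..b}"
  shows "(dissipation has_real_derivative \<alpha> * t powr (- q) * (norm (x' t))\<^sup>2) (at t within {a..b})"
proof -
  have "(dissipation has_real_derivative \<alpha> * t powr (- q) * (norm (x' t))\<^sup>2) (at t within {t0..b})"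
    unfolding dissipation_def
    by (rule integral_has_real_derivative[OF continuous_on_dissipation_rate]) (use assms in auto)
  then show ?thesis by (rule has_field_derivative_subset) (use assms in auto)
qed

text \<open>Almost everywhere the derivative is the vertex inequality of \<open>dynamics\<close>
  plus the nonpositive term from the decreasing regularization weight. Thus every component decays,
  although the equation of motion contains only one convex combination of the gradients.\<close>

lemma energy_component_nonincreasing:
  assumes s: "t0 \<le> s" "s \<le> T"
  shows "freg f \<beta> p T i (x T) + (norm (x' T))\<^sup>2 / 2 + dissipation T
    \<le> freg f \<beta> p s i (x s) + (norm (x' s))\<^sup>2 / 2 + dissipation s"
proof -
  define V where "V t = f i (x t) + \<beta> / 2 * (t powr (- p) * inner (x t) (x t)) + dissipation t" for t
  define V' where "V' t = inner (g i (x t)) (x' t)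
      + \<beta> / 2 * (- p * t powr (- p - 1) * inner (x t) (x t)
          + (inner (x t) (x' t) + inner (x' t) (x t)) * t powr (- p))
      + \<alpha> * t powr (- q) * (norm (x' t))\<^sup>2" for t
  define F where "F t = V t + (1 / 2) *\<^sub>R inner (x' t) (x' t)" for t
  have pos: "t > 0" if "t \<in> {s..T}" for t using that s t0 by auto
  have V: "(V has_real_derivative V' t) (at t within {s..T})" if t: "t \<in> {s..T}" for t
  proof -
    have "((\<lambda>t. t powr (- p)) has_real_derivative - p * t powr (- p - 1)) (at t within {s..T})"
      by (rule has_field_derivative_at_within[OF has_real_derivative_powr[OF pos[OF t]]])
    moreover have "((\<lambda>t. f i (x t)) has_real_derivative inner (g i (x t)) (x' t)) (at t within {s..T})"
      using vector_derivative_diff_chain_within[OF x_deriv[OF s(1) t] has_derivative_at_withinI[OF grad]]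
      by (simp add: has_real_derivative_iff_has_vector_derivative o_def)
    ultimately show ?thesis
      unfolding V_def V'_def
      by (intro DERIV_add DERIV_cmult DERIV_mult has_real_derivative_inner x_deriv s(1) t dissipation_deriv)
  qed
  have x'_cont: "continuous_on {s..T} x'" using s by (intro continuous_on_x') auto
  have "continuous_on {s..T} V'"
    unfolding V'_def
    by (intro continuous_intros continuous_on_dissipation_rate continuous_on_x s x'_cont
        continuous_on_compose2[OF continuous_on_g[of UNIV]]) (auto dest: pos)
  then have "abs_cont_on {s..T} V" using V by (rule abs_cont_on_C1_real)
  moreover have "bounded (x' ` {s..T})"
    by (intro compact_imp_bounded compact_continuous_image x'_cont) simp
  ultimately have ac: "abs_cont_on {s..T} F"
    unfolding F_def by (intro abs_cont_on_add abs_cont_on_scaleR abs_cont_on_inner abs_cont_x' s)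
  have "F T \<le> F s"
  proof (rule abs_cont_on_nonincreasing[OF s(2) ac])
    from dynamics show "AE t in lborel. t \<in> {s<..<T} \<longrightarrow> (\<exists>D\<le>0. (F has_real_derivative D) (at t))"
    proof eventually_elim
      case (elim t)
      show ?case
      proof
        assume tin: "t \<in> {s<..<T}"
        then have t: "t \<in> {s..T}" "t \<ge> t0" and at: "at t within {s..T} = at t"
          using s by (auto simp: at_within_Icc_at)
        define D where "D = V' t + (1 / 2) * (inner (x' t) (x'' t) + inner (x'' t) (x' t))"
        have "(F has_real_derivative D) (at t)"
          unfolding F_def D_def real_scaleR_def using elim t(2)
          by (intro DERIV_add DERIV_cmult has_real_derivative_inner V[OF t(1), unfolded at]) blast+
        moreover have "D = inner (x' t) (g i (x t) + (\<beta> * t powr (- p)) *\<^sub>R x t + x'' t + (\<alpha> * t powr (- q)) *\<^sub>R x' t)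
            - \<beta> / 2 * (p * t powr (- p - 1) * inner (x t) (x t))"
          unfolding D_def V'_def
          by (simp add: inner_add_right power2_norm_eq_inner inner_commute[of "x t" "x' t"]
              inner_commute[of "g i (x t)" "x' t"] inner_commute[of "x'' t" "x' t"] algebra_simps)
        moreover have "\<beta> / 2 * (p * t powr (- p - 1) * inner (x t) (x t)) \<ge> 0"
          using \<beta> p q by simp
        ultimately show "\<exists>D\<le>0. (F has_real_derivative D) (at t)"
          using elim t(2) by (smt (verit))
      qed
    qed
  qed
  then show ?thesis by (simp add: F_def V_def freg_eq power2_norm_eq_inner)
qed

abbreviation z :: "real \<Rightarrow> 'a" where "z t \<equiv> zreg f \<beta> p t (x t)"

abbreviation gap :: "real \<Rightarrow> real" where "gap t \<equiv> merit (freg f \<beta> p t) (x t)"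

lemma gap_nonneg: "t \<ge> t0 \<Longrightarrow> 0 \<le> gap t"
  using t0 \<beta> by (intro merit_eq_at_argmin(2)[where h = "freg f \<beta> p t" and z = "z t"] zreg_argmin) auto

lemma gap_le: "t \<ge> t0 \<Longrightarrow> gap t \<le> freg f \<beta> p t i (x t) - freg f \<beta> p t i (z t)"
  using merit_eq_at_argmin(1)[where h = "freg f \<beta> p t" and z = "z t" and y = "x t", OF zreg_argmin] t0 \<beta>
  by simp

lemma trajectory_bound:
  obtains R where "\<And>t. t \<ge> t0 \<Longrightarrow> norm (x t) \<le> R" "\<And>t. t \<ge> t0 \<Longrightarrow> norm (z t) \<le> R"
    "\<And>t. t \<ge> t0 \<Longrightarrow> norm (proj_minimizer (x t)) \<le> R"
proof -
  obtain R1 where R1: "\<And>t. t \<ge> t0 \<Longrightarrow> norm (x t) \<le> R1"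
    using bdd unfolding bounded_iff by auto
  obtain R2 where R2: "\<And>t. t \<ge> t0 \<Longrightarrow> norm (proj_minimizer (x t)) \<le> R2"
    using proj_minimizer_bounded[OF bdd] unfolding bounded_iff by auto
  have R3: "norm (z t) \<le> R2" if "t \<ge> t0" for t
    using norm_zreg_le[OF \<beta>, of t p "x t"] R2[OF that] that t0 by linarith
  show ?thesis
    by (rule that[of "max R1 R2"]) (use R1 R2 R3 in \<open>auto simp: le_max_iff_disj\<close>)
qed

text \<open>Energy decay from \<open>t\<close> to \<open>T\<close> brings the value at
  \<open>x t\<close> down to the one at \<open>x T\<close>, where \<open>gap_le\<close> applies.
  Replacing the weight of time \<open>T\<close> by that of time \<open>t\<close> at the fixed point
  \<open>z T\<close> costs at most the last summand.\<close>

lemma frozen_gap_lower_bound: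
  assumes t: "t0 \<le> t" "t \<le> T" and R: "norm (z T) \<le> R"
  shows "gap T + (norm (x' T))\<^sup>2 / 2 + dissipation T - dissipation t
    \<le> freg f \<beta> p t i (x t) - freg f \<beta> p t i (z T) + (norm (x' t))\<^sup>2 / 2 + \<beta> / 2 * R\<^sup>2 * t powr (- p)"
proof -
  have "freg f \<beta> p t i (z T) \<le> freg f \<beta> p T i (z T) + \<beta> / 2 * R\<^sup>2 * t powr (- p)"
  proof -
    have "\<beta> / 2 * (t powr (- p) * (norm (z T))\<^sup>2) \<le> \<beta> / 2 * (t powr (- p) * R\<^sup>2)"
      using \<beta> R by (intro mult_left_mono power_mono) auto
    then show ?thesis
      using f_le_freg[of i "z T" T] unfolding freg_eq[of t i "z T"] by (simp add: algebra_simps)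
  qed
  then show ?thesis
    using energy_component_nonincreasing[OF t, of i] gap_le[of T i] t by linarith
qed

text \<open>Convexity, with the quadratic term expanded exactly, puts every gradient into one
  half-space. The half-space then contains the whole hull, so the unknown multipliers in
  \<open>c\<close> never have to be identified.\<close>

lemma second_derivative_bound:
  assumes "\<And>i. \<Gamma> \<le> freg f \<beta> p t i (x t) - freg f \<beta> p t i u"
    and c: "c \<in> convex hull (range (\<lambda>i. g i (x t)))"
    and x'': "x'' t = - c - (\<beta> * t powr (- p)) *\<^sub>R x t - (\<alpha> * t powr (- q)) *\<^sub>R x' t"
  shows "inner (x t - u) (x'' t) \<le> - \<Gamma> - \<alpha> * t powr (- q) * inner (x t - u) (x' t)"
proof -
  define b where "b = \<beta> * t powr (- p)"
  have b: "b \<ge> 0" using \<beta> by (simp add: b_def)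
  have "convex hull (range (\<lambda>i. g i (x t))) \<subseteq> {c. inner (x t - u) c \<ge> \<Gamma> - b * inner (x t - u) (x t)}"
  proof (rule hull_minimal)
    show "range (\<lambda>i. g i (x t)) \<subseteq> {c. inner (x t - u) c \<ge> \<Gamma> - b * inner (x t - u) (x t)}"
    proof clarify
      fix i
      have "0 \<le> b / 2 * (norm (x t - u))\<^sup>2" using b by simp
      also have "\<dots> = b * inner (x t - u) (x t) - b / 2 * (norm (x t))\<^sup>2 + b / 2 * (norm u)\<^sup>2"
        by (simp add: power2_norm_eq_inner inner_diff_left inner_diff_right inner_commute[of u "x t"] algebra_simps)
      finally have "b / 2 * (norm (x t))\<^sup>2 - b / 2 * (norm u)\<^sup>2 \<le> b * inner (x t - u) (x t)" by simp
      moreover have "inner (g i (x t)) (u - x t) = - inner (x t - u) (g i (x t))"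
        by (simp add: inner_commute[of "g i (x t)" "u - x t"] inner_diff_left)
      then have "f i (x t) - f i u \<le> inner (x t - u) (g i (x t))"
        using gradient_ineq[of i "x t" u] by linarith
      ultimately show "\<Gamma> - b * inner (x t - u) (x t) \<le> inner (x t - u) (g i (x t))"
        using assms(1)[of i] unfolding freg_eq b_def by (simp add: algebra_simps)
    qed
  qed (rule convex_halfspace_ge)
  then have "inner (x t - u) c \<ge> \<Gamma> - b * inner (x t - u) (x t)" using c by blast
  then show ?thesis
    unfolding x'' b_def[symmetric] by (simp add: inner_diff_right)
qed

section \<open>Uniform bounds and rates\<close>

lemma eventually_damping_dominates:
  "eventually (\<lambda>t. 3 * q * t powr (2 * q - 1) \<le> \<alpha> * t powr q) at_top"
proof -
  have "((\<lambda>t. 3 * q * t powr (q - 1)) \<longlongrightarrow> 3 * q * 0) at_top"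
    using q by (intro tendsto_intros tendsto_neg_powr filterlim_ident) auto
  then have "eventually (\<lambda>t. 3 * q * t powr (q - 1) < \<alpha>) at_top"
    using \<alpha> by (intro order_tendstoD) auto
  then show ?thesis
    using eventually_gt_at_top[of 0]
  proof eventually_elim
    case (elim t)
    have "3 * q * t powr (2 * q - 1) = 3 * q * t powr (q - 1) * t powr q"
      by (simp add: powr_add[symmetric])
    also have "\<dots> \<le> \<alpha> * t powr q" using elim by (intro mult_right_mono) auto
    finally show ?case .
  qed
qed

text \<open>\<open>damped_rate_estimate\<close> is applied on \<open>{t1..T}\<close> with comparison
  point \<open>z T\<close> and read off at the right end. The point is that \<open>K\<close> depends
  on \<open>t1\<close> but not on \<open>T\<close>, although the comparison point does.\<close>

lemma velocity_gap_rate: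
  obtains K t1 where "1 \<le> t1" "t0 \<le> t1"
    "\<And>T. t1 \<le> T \<Longrightarrow> T powr (2 * q) * gap T + (T powr q * norm (x' T))\<^sup>2 / 4 \<le> K"
proof -
  obtain R where R: "\<And>t. t \<ge> t0 \<Longrightarrow> norm (x t) \<le> R" "\<And>t. t \<ge> t0 \<Longrightarrow> norm (z t) \<le> R"
    by (rule trajectory_bound) blast
  have R0: "R \<ge> 0" using R(1)[of t0] norm_ge_zero order_trans by blast
  obtain t2 where t2: "\<And>t. t \<ge> t2 \<Longrightarrow> 3 * q * t powr (2 * q - 1) \<le> \<alpha> * t powr q"
    using eventually_damping_dominates unfolding eventually_at_top_linorder by blast
  define t1 where "t1 = max (max 1 t0) t2"
  have t1: "1 \<le> t1" "t0 \<le> t1" "t2 \<le> t1" by (auto simp: t1_def)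
  define C where "C = \<beta> / 2 * R\<^sup>2"
  define M where "M = 2 * R\<^sup>2"
  define i :: 'm where "i = undefined"
  \<comment> \<open>A bound for \<open>G t1\<close> in which the unknown value of \<open>f i\<close>
    at \<open>z T\<close> is replaced by its lower bound on the ball of radius \<open>R\<close>;
    this makes it independent of \<open>T\<close>.\<close>
  define G1 where "G1 = freg f \<beta> p t1 i (x t1) - (f i 0 - norm (g i 0) * R) + (norm (x' t1))\<^sup>2 / 2 + C * t1 powr (- p)"
  define K0 where "K0 = t1 powr (2 * q) * G1 + 2 * q * t1 powr (2 * q - 1) * (2 * R * norm (x' t1))
      + 2 * q * \<alpha> * t1 powr (q - 1) * M + 2 * q * C / (p - 2 * q) * t1 powr (2 * q - p)
      + 4 * q * \<bar>2 * q - 1\<bar> * M * t1 powr (2 * q - 2)"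
  have "T powr (2 * q) * gap T + (T powr q * norm (x' T))\<^sup>2 / 4 \<le> K0 + (4 * q * R)\<^sup>2" if T: "t1 \<le> T" for T
  proof -
    have T0: "t0 \<le> T" using T t1 by simp
    define u where "u = z T"
    have u: "norm u \<le> R" using R(2)[OF T0] by (simp add: u_def)
    have dist: "norm (x t - u) \<le> 2 * R" if "t \<ge> t0" for t
      using norm_triangle_ineq4[of "x t" u] R(1)[OF that] u by linarith
    define h where "h t = 1 / 2 * inner (x t - u) (x t - u)" for t
    define h' where "h' t = inner (x t - u) (x' t)" for t
    \<comment> \<open>Gap and kinetic energy at \<open>T\<close> plus the energy still to be
      dissipated. At \<open>t = T\<close> the dissipation cancels, so the final estimate controls
      gap and velocity.\<close>
    define G where "G t = (gap T + (norm (x' T))\<^sup>2 / 2 + dissipation T) - dissipation t" for t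
    have h'_bound: "\<bar>h' t\<bar> \<le> 2 * R * norm (x' t)" if "t \<ge> t0" for t
    proof -
      have "\<bar>h' t\<bar> \<le> norm (x t - u) * norm (x' t)" unfolding h'_def by (rule Cauchy_Schwarz_ineq2)
      also have "\<dots> \<le> 2 * R * norm (x' t)" using dist[OF that] by (intro mult_right_mono) auto
      finally show ?thesis .
    qed
    have xu: "((\<lambda>t. x t - u) has_vector_derivative x' t) (at t within {t1..T})" if "t \<in> {t1..T}" for t
      using has_vector_derivative_diff[OF x_deriv[OF t1(2) that] has_vector_derivative_const[of u]] by simp
    have x'_cont: "continuous_on {t1..T} x'" using t1 by (intro continuous_on_x') auto
    have "T powr (2 * q) * G T + 2 * q * T powr (2 * q - 1) * h' T
      \<le> t1 powr (2 * q) * G t1 + 2 * q * t1 powr (2 * q - 1) * h' t1 + 2 * q * \<alpha> * t1 powr (q - 1) * M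
      + 2 * q * C / (p - 2 * q) * t1 powr (2 * q - p) + 4 * q * \<bar>2 * q - 1\<bar> * M * t1 powr (2 * q - 2)"
    proof (rule damped_rate_estimate[where h = h and e = "\<lambda>t. (norm (x' t))\<^sup>2" and \<alpha> = \<alpha>])
      show "3 * q * t powr (2 * q - 1) \<le> \<alpha> * t powr q" if "t1 \<le> t" for t
        using t2 that t1 by simp
      show "(h has_real_derivative h' t) (at t within {t1..T})" if t: "t \<in> {t1..T}" for t
        unfolding h_def h'_def
        by (rule DERIV_cong[OF DERIV_cmult[OF has_real_derivative_inner[OF xu[OF t] xu[OF t]]]])
          (simp add: inner_commute)
      show "0 \<le> h t" for t by (simp add: h_def)
      show "h t \<le> M" if "t \<in> {t1..T}" for t
      proof -
        have "(norm (x t - u))\<^sup>2 \<le> (2 * R)\<^sup>2"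
          using dist[of t] that t1 by (intro power_mono) auto
        then show ?thesis by (simp add: h_def M_def power2_norm_eq_inner[symmetric] power_mult_distrib)
      qed
      show "continuous_on {t1..T} h'" unfolding h'_def
        by (intro continuous_intros x'_cont continuous_on_x t1)
      have "abs_cont_on {t1..T} (\<lambda>t. x t - u)" by (rule abs_cont_on_C1[OF x'_cont xu])
      then show "abs_cont_on {t1..T} h'" unfolding h'_def
        by (intro abs_cont_on_inner abs_cont_x' t1 T compact_imp_bounded compact_continuous_image
            continuous_intros x'_cont continuous_on_x compact_Icc)
      show "continuous_on {t1..T} (\<lambda>t. (norm (x' t))\<^sup>2)" by (intro continuous_intros x'_cont)
      show "(G has_real_derivative - (\<alpha> * t powr - q * (norm (x' t))\<^sup>2)) (at t within {t1..T})"
        if t: "t \<in> {t1..T}" for t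
        unfolding G_def
        using DERIV_diff[OF DERIV_const dissipation_deriv[OF t1(2) t]] by simp
      from dynamics show "AE t in lborel. t \<in> {t1<..<T} \<longrightarrow> (\<exists>h2. (h' has_real_derivative h2) (at t) \<and>
        h2 \<le> 3 / 2 * (norm (x' t))\<^sup>2 + C * t powr (- p) - \<alpha> * t powr (- q) * h' t - G t)"
      proof eventually_elim
        case (elim t)
        show ?case
        proof
          assume tin: "t \<in> {t1<..<T}"
          then have t: "t \<in> {t1..T}" "t \<ge> t0" and at: "at t within {t1..T} = at t"
            using t1 by (auto simp: at_within_Icc_at)
          have "(h' has_real_derivative inner (x t - u) (x'' t) + inner (x' t) (x' t)) (at t)"
            unfolding h'_def using elim t(2)
            by (intro has_real_derivative_inner xu[OF t(1), unfolded at]) blast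
          moreover have "G t - (norm (x' t))\<^sup>2 / 2 - C * t powr (- p) \<le> freg f \<beta> p t i (x t) - freg f \<beta> p t i u" for i
            using frozen_gap_lower_bound[OF t(2) _ R(2)[OF T0], of i] t(1) unfolding G_def C_def u_def by simp
          then have "inner (x t - u) (x'' t)
              \<le> - (G t - (norm (x' t))\<^sup>2 / 2 - C * t powr (- p)) - \<alpha> * t powr (- q) * inner (x t - u) (x' t)"
            using second_derivative_bound elim t(2) by blast
          then have "inner (x t - u) (x'' t) + inner (x' t) (x' t)
              \<le> 3 / 2 * (norm (x' t))\<^sup>2 + C * t powr (- p) - \<alpha> * t powr (- q) * h' t - G t"
            by (simp add: h'_def power2_norm_eq_inner)
          ultimately show "\<exists>h2. (h' has_real_derivative h2) (at t) \<and>
            h2 \<le> 3 / 2 * (norm (x' t))\<^sup>2 + C * t powr (- p) - \<alpha> * t powr (- q) * h' t - G t" by blast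
        qed
      qed
    qed (use t1 T q p \<alpha> \<beta> in \<open>auto simp: C_def\<close>)
    also have "\<dots> \<le> K0"
    proof -
      have "G t1 \<le> G1"
        using frozen_gap_lower_bound[OF t1(2) T R(2)[OF T0], of i] f_lower_bound[OF R(2)[OF T0], of i]
          f_le_freg[of i "z T" t1] unfolding G_def G1_def C_def by linarith
      moreover have "h' t1 \<le> 2 * R * norm (x' t1)" using h'_bound[OF t1(2)] by linarith
      ultimately have "t1 powr (2 * q) * G t1 \<le> t1 powr (2 * q) * G1"
        "2 * q * t1 powr (2 * q - 1) * h' t1 \<le> 2 * q * t1 powr (2 * q - 1) * (2 * R * norm (x' t1))"
        using q by (intro mult_left_mono; simp)+
      then show ?thesis unfolding K0_def by linarith
    qed
    finally have est: "T powr (2 * q) * G T + 2 * q * T powr (2 * q - 1) * h' T \<le> K0" .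
    define s where "s = T powr q * norm (x' T)"
    have "T powr (2 * q) = (T powr q)\<^sup>2" by (simp add: power2_eq_square powr_add[symmetric])
    then have GT: "T powr (2 * q) * G T = T powr (2 * q) * gap T + s\<^sup>2 / 2"
      by (simp add: G_def s_def power_mult_distrib algebra_simps)
    \<comment> \<open>Here \<open>T \<ge> 1\<close> and \<open>q < 1\<close> allow the exponent
      \<open>2 * q - 1\<close> to be raised to \<open>q\<close>.\<close>
    have "T powr (2 * q - 1) * \<bar>h' T\<bar> \<le> T powr q * (2 * R * norm (x' T))"
      using h'_bound[OF T0] t1 T q by (intro mult_mono powr_mono) auto
    then have "2 * q * (T powr (2 * q - 1) * \<bar>h' T\<bar>) \<le> 2 * q * (2 * R * s)"
      using q by (intro mult_left_mono) (auto simp: s_def algebra_simps)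
    moreover have "- (2 * q * (T powr (2 * q - 1) * \<bar>h' T\<bar>)) \<le> 2 * q * T powr (2 * q - 1) * h' T"
    proof -
      have "2 * q * T powr (2 * q - 1) * - \<bar>h' T\<bar> \<le> 2 * q * T powr (2 * q - 1) * h' T"
        using q by (intro mult_left_mono) auto
      then show ?thesis by (simp only: mult_minus_right mult.assoc)
    qed
    \<comment> \<open>Young's inequality: half of the available \<open>s\<^sup>2 / 2\<close> absorbs
      the cross term, which leaves \<open>s\<^sup>2 / 4\<close> and the constant
      \<open>(4 * q * R)\<^sup>2\<close>.\<close>
    moreover have "0 \<le> (s / 2 - 4 * q * R)\<^sup>2" by simp
    then have "4 * q * R * s \<le> s\<^sup>2 / 4 + (4 * q * R)\<^sup>2"
      by (simp add: power2_eq_square algebra_simps)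
    moreover have "2 * q * (2 * R * s) = 4 * q * R * s" by simp
    ultimately show ?thesis using est unfolding GT s_def[symmetric] by linarith
  qed
  then show ?thesis using that t1 by blast
qed

lemma scaled_bounds:
  obtains K t1 where "1 \<le> t1" "t0 \<le> t1" "0 \<le> K"
    "\<And>t. t1 \<le> t \<Longrightarrow> t powr (2 * q) * gap t \<le> K" "\<And>t. t1 \<le> t \<Longrightarrow> t powr q * norm (x' t) \<le> K"
    "\<And>t. t1 \<le> t \<Longrightarrow> t powr (2 * q) * merit f (x t) \<le> K" "\<And>t. t1 \<le> t \<Longrightarrow> norm (x t - z t) \<le> K"
proof -
  obtain R where R: "\<And>t. t \<ge> t0 \<Longrightarrow> norm (x t) \<le> R" "\<And>t. t \<ge> t0 \<Longrightarrow> norm (z t) \<le> R"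
    "\<And>t. t \<ge> t0 \<Longrightarrow> norm (proj_minimizer (x t)) \<le> R"
    by (rule trajectory_bound) blast
  have R0: "R \<ge> 0" using R(1)[of t0] norm_ge_zero order_trans by blast
  obtain L t1 where t1: "1 \<le> t1" "t0 \<le> t1"
    and L: "\<And>T. t1 \<le> T \<Longrightarrow> T powr (2 * q) * gap T + (T powr q * norm (x' T))\<^sup>2 / 4 \<le> L"
    by (rule velocity_gap_rate) blast
  have gap: "0 \<le> t powr (2 * q) * gap t" if "t1 \<le> t" for t
    using gap_nonneg[of t] that t1 by simp
  have L0: "L \<ge> 0" using L[of t1] gap[of t1] by (smt (verit) divide_nonneg_pos zero_le_power2)
  \<comment> \<open>The four summands serve the regularized gap, the velocity (through
    \<open>s \<le> s\<^sup>2 / 4 + 1\<close>), the merit function (through \<open>2 * q < p\<close>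
    and \<open>t \<ge> 1\<close>) and the distance to \<open>z t\<close>.\<close>
  define K where "K = L + (L + 1) + (L + \<beta> / 2 * R\<^sup>2) + 2 * R"
  have \<beta>R: "\<beta> / 2 * R\<^sup>2 \<ge> 0" using \<beta> by simp
  show ?thesis
  proof (rule that[of t1 K])
    show "1 \<le> t1" "t0 \<le> t1" by fact+
    show "0 \<le> K" using L0 \<beta>R R0 by (simp add: K_def)
    fix t assume t: "t1 \<le> t"
    then have t': "t \<ge> t0" "t \<ge> 1" using t1 by auto
    define s where "s = t powr q * norm (x' t)"
    have Lt: "t powr (2 * q) * gap t + s\<^sup>2 / 4 \<le> L" using L[OF t] by (simp add: s_def)
    have s2: "0 \<le> s\<^sup>2 / 4" by simp
    show 1: "t powr (2 * q) * gap t \<le> K"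
      using Lt s2 L0 \<beta>R R0 unfolding K_def by linarith
    have "0 \<le> (s / 2 - 1)\<^sup>2" by simp
    then have "s \<le> s\<^sup>2 / 4 + 1" by (simp add: power2_eq_square algebra_simps)
    then show "t powr q * norm (x' t) \<le> K"
      using Lt gap[OF t] L0 \<beta>R R0 unfolding K_def s_def[symmetric] by linarith
    show "norm (x t - z t) \<le> K"
      using norm_triangle_ineq4[of "x t" "z t"] R(1,2)[OF t'(1)] L0 \<beta>R unfolding K_def by linarith
    have "\<beta> / (2 * t powr p) * (norm (proj_minimizer (x t)))\<^sup>2 \<le> \<beta> / (2 * t powr p) * R\<^sup>2"
      using \<beta> R(3)[OF t'(1)] by (intro mult_left_mono power_mono) simp_all
    then have "merit f (x t) \<le> gap t + \<beta> / 2 * R\<^sup>2 * t powr (- p)"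
    proof -
      have "\<beta> / (2 * t powr p) * R\<^sup>2 = \<beta> / 2 * R\<^sup>2 * t powr (- p)"
        by (simp add: powr_minus divide_simps)
      moreover have "t > 0" using t0 t'(1) by linarith
      ultimately show ?thesis
        using \<open>_ \<le> \<beta> / (2 * t powr p) * R\<^sup>2\<close> merit_le_merit_freg[OF \<beta>, of t "x t" p] by linarith
    qed
    then have "t powr (2 * q) * merit f (x t) \<le> t powr (2 * q) * (gap t + \<beta> / 2 * R\<^sup>2 * t powr (- p))"
      by (intro mult_left_mono) auto
    also have "\<dots> = t powr (2 * q) * gap t + \<beta> / 2 * R\<^sup>2 * t powr (2 * q - p)"
      by (simp add: distrib_left powr_add[symmetric])
    also have "\<dots> \<le> t powr (2 * q) * gap t + \<beta> / 2 * R\<^sup>2 * 1"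
      using p t'(2) \<beta>R powr_mono[of "2 * q - p" 0 t] by (intro add_left_mono mult_left_mono) auto
    finally show "t powr (2 * q) * merit f (x t) \<le> K"
      using Lt s2 L0 R0 unfolding K_def by linarith
  qed
qed

lemma merit_nonneg: "0 \<le> merit f y"
  by (rule merit_eq_at_argmin(2)[where z = "proj_minimizer y"]) (rule proj_minimizer_argmin)

theorem rates:
  shows "(\<lambda>t. energy f \<alpha> \<beta> q p x x' q lam t) \<in> O[at_top](\<lambda>_. 1)"
    and "(\<lambda>t. gap t) \<in> O[at_top](\<lambda>t. t powr (-2 * q))"
    and "(\<lambda>t. merit f (x t)) \<in> O[at_top](\<lambda>t. t powr (-2 * q))"
    and "(\<lambda>t. norm (x t - z t)) \<in> O[at_top](\<lambda>_. 1)"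
    and "(\<lambda>t. norm (x' t)) \<in> O[at_top](\<lambda>t. t powr (- q))"
proof -
  obtain K t1 where t1: "1 \<le> t1" "t0 \<le> t1" and K0: "0 \<le> K"
    and K: "\<And>t. t1 \<le> t \<Longrightarrow> t powr (2 * q) * gap t \<le> K" "\<And>t. t1 \<le> t \<Longrightarrow> t powr q * norm (x' t) \<le> K"
    "\<And>t. t1 \<le> t \<Longrightarrow> t powr (2 * q) * merit f (x t) \<le> K" "\<And>t. t1 \<le> t \<Longrightarrow> norm (x t - z t) \<le> K"
    by (rule scaled_bounds) blast
  \<comment> \<open>Landau bounds concern absolute values while the scaled bounds are one-sided,
    hence the nonnegativity premise.\<close>
  have bigo: "h \<in> O[at_top](\<lambda>t. t powr (- a))"
    if "\<And>t. t1 \<le> t \<Longrightarrow> 0 \<le> h t" "\<And>t. t1 \<le> t \<Longrightarrow> t powr a * h t \<le> B" for h :: "real \<Rightarrow> real" and a B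
  proof (rule bigoI[of _ B])
    show "eventually (\<lambda>t. norm (h t) \<le> B * norm (t powr (- a))) at_top"
      using eventually_ge_at_top[of t1]
    proof eventually_elim
      case (elim t)
      have "h t = t powr (- a) * (t powr a * h t)"
        using elim t1 by (simp add: mult.assoc[symmetric] powr_add[symmetric])
      also have "\<dots> \<le> t powr (- a) * B" by (intro mult_left_mono that elim) simp
      finally show ?case using that(1)[OF elim] by (simp add: mult.commute)
    qed
  qed
  show "(\<lambda>t. gap t) \<in> O[at_top](\<lambda>t. t powr (-2 * q))"
    using bigo[of gap "2 * q" K] K(1) gap_nonneg t1 by simp
  show "(\<lambda>t. merit f (x t)) \<in> O[at_top](\<lambda>t. t powr (-2 * q))"
    using bigo[of "\<lambda>t. merit f (x t)" "2 * q" K] K(3) merit_nonneg by simp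
  show "(\<lambda>t. norm (x' t)) \<in> O[at_top](\<lambda>t. t powr (- q))"
    using bigo[of "\<lambda>t. norm (x' t)" q K] K(2) by simp
  show "(\<lambda>t. norm (x t - z t)) \<in> O[at_top](\<lambda>_. 1)"
    using K(4) by (intro bigoI[of _ K] eventually_mono[OF eventually_ge_at_top[of t1]]) auto
  \<comment> \<open>The energy is bounded summand by summand. In the last coefficient
    \<open>t powr (q - 1) \<le> 1\<close> and \<open>t powr (q - q) = 1\<close>.\<close>
  define E where "E = K + 1 / 2 * (\<bar>lam\<bar> * K + K)\<^sup>2 + \<bar>lam\<bar> / 2 * (q + \<alpha> + 2 * \<bar>lam\<bar>) * K\<^sup>2"
  show "(\<lambda>t. energy f \<alpha> \<beta> q p x x' q lam t) \<in> O[at_top](\<lambda>_. 1)"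
  proof (rule bigoI[of _ E])
    show "eventually (\<lambda>t. norm (energy f \<alpha> \<beta> q p x x' q lam t) \<le> E * norm (1 :: real)) at_top"
      using eventually_ge_at_top[of t1]
    proof eventually_elim
      case (elim t)
      have "\<bar>t powr (2 * q) * gap t\<bar> \<le> K"
        using K(1)[OF elim] gap_nonneg[of t] elim t1 by simp
      moreover have "\<bar>1 / 2 * (norm (lam *\<^sub>R (x t - z t) + (t powr q) *\<^sub>R x' t))\<^sup>2\<bar>
          \<le> 1 / 2 * (\<bar>lam\<bar> * K + K)\<^sup>2"
      proof -
        have "norm (lam *\<^sub>R (x t - z t) + (t powr q) *\<^sub>R x' t) \<le> \<bar>lam\<bar> * norm (x t - z t) + t powr q * norm (x' t)"
          by (rule norm_triangle_le) simp
        also have "\<dots> \<le> \<bar>lam\<bar> * K + K"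
          using K(2,4)[OF elim] by (intro add_mono mult_left_mono) auto
        finally show ?thesis by (simp add: power_mono)
      qed
      moreover have "\<bar>lam / 2 * (q * t powr (q - 1) + \<alpha> * t powr (q - q) - 2 * lam) * (norm (x t - z t))\<^sup>2\<bar>
          \<le> \<bar>lam\<bar> / 2 * (q + \<alpha> + 2 * \<bar>lam\<bar>) * K\<^sup>2"
      proof -
        have "t powr (q - 1) \<le> 1"
          using powr_mono[of "q - 1" 0 t] q elim t1 by simp
        then have "q * t powr (q - 1) \<le> q" "0 \<le> q * t powr (q - 1)" using q by simp_all
        then have "\<bar>q * t powr (q - 1) + \<alpha> * t powr (q - q) - 2 * lam\<bar> \<le> q + \<alpha> + 2 * \<bar>lam\<bar>"
          using elim t1 \<alpha> by simp
        moreover have "(norm (x t - z t))\<^sup>2 \<le> K\<^sup>2" using K(4)[OF elim] by (simp add: power_mono)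
        ultimately show ?thesis
          unfolding abs_mult using q \<alpha> by (intro mult_mono) auto
      qed
      moreover have "\<bar>a + b + c\<bar> \<le> A + B + C" if "\<bar>a\<bar> \<le> A" "\<bar>b\<bar> \<le> B" "\<bar>c\<bar> \<le> C" for a b c A B C :: real
        using that by linarith
      ultimately show ?case
        unfolding energy_def Let_def E_def real_norm_def abs_one mult_1_right by blast
    qed
  qed
qed

end

theorem mainTheorem12:
  fixes f :: "'m::finite \<Rightarrow> 'a::{real_inner,complete_space} \<Rightarrow> real"
    and g :: "'m \<Rightarrow> 'a \<Rightarrow> 'a"
    and t0 \<alpha> \<beta> q p :: real and x0 v0 :: 'a
    and x x' x'' :: "real \<Rightarrow> 'a"
  assumes convex: "\<And>i. convex_on UNIV (f i)"
    and grad: "\<And>i y. (f i has_derivative (\<lambda>h. inner (g i y) h)) (at y)"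
    and lipschitz: "\<And>i. \<exists>L. \<forall>y u. norm (g i y - g i u) \<le> L * norm (y - u)"
    and t0: "t0 > 0" and alpha: "\<alpha> > 0" and beta: "\<beta> > 0"
    and q: "0 < q" "q \<le> 1" and p: "0 < p" "p \<le> 2" and qp: "q < p / 2"
    and A3: "let a = (\<chi> i. \<beta> / (2 * t0 powr p) * (norm x0)\<^sup>2 + 1/2 * (norm v0)\<^sup>2) in
               (\<forall>y \<in> level_set f (Fvec f x0 + a). LPw f (Fvec f y) \<noteq> {}) \<and>
               (\<exists>R. \<forall>y \<in> LPw f (Fvec f x0 + a). Inf (norm ` {z. Fvec f z = Fvec f y}) \<le> R)"
    and A4: "\<forall>w. Sset f w \<noteq> {}" "continuous_on UNIV (\<lambda>w. proj (Sset f w) 0)"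
    and sol: "mtrigs_solution f g t0 \<alpha> \<beta> q p x0 v0 x x' x''"
    and bdd: "bounded (x ` {t0..})"
  shows "(\<forall>lam. 0 < lam \<and> lam < \<alpha> / 2 \<longrightarrow>
            (\<lambda>t. energy f \<alpha> \<beta> q p x x' q lam t) \<in> O[at_top](\<lambda>_. 1))
       \<and> (\<lambda>t. merit (freg f \<beta> p t) (x t)) \<in> O[at_top](\<lambda>t. t powr (-2 * q))
       \<and> (\<lambda>t. merit f (x t)) \<in> O[at_top](\<lambda>t. t powr (-2 * q))
       \<and> (\<lambda>t. norm (x t - zreg f \<beta> p t (x t))) \<in> O[at_top](\<lambda>_. 1)
       \<and> (\<lambda>t. norm (x' t)) \<in> O[at_top](\<lambda>t. t powr (- q))"
proof -
  interpret mtrigs_trajectory f g t0 \<alpha> \<beta> q p x0 v0 x x' x''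
  proof unfold_locales
    show "convex_on UNIV (f i)" for i by (rule convex)
    show "(f i has_derivative (\<lambda>h. inner (g i y) h)) (at y)" for i y by (rule grad)
    show "\<exists>L. \<forall>y u. norm (g i y - g i u) \<le> L * norm (y - u)" for i by (rule lipschitz)
    show "Sset f w \<noteq> {}" for w using A4(1) by blast
    \<comment> \<open>The strict bound on \<open>q\<close> comes from \<open>q < p / 2\<close>
      together with \<open>p \<le> 2\<close>.\<close>
    show "q < 1" "2 * q < p" using p qp by linarith+
  qed (fact A4(2) t0 alpha beta q(1) sol bdd)+
  show ?thesis by (intro conjI allI impI rates)
qed

end
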